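(* Let $G$ be a 2-ball, whose boundary is a cyclic graph of length $L$. There exists a finite sequence of edge refinements, each performed at an interior edge, which transforms $G$ into a graph in which every vertex has even degree, if and only if $L$ is divisible by $3$.
   Context: All graphs are finite simple graphs; $S(x)$ denotes the unit sphere of a vertex $x$, the subgraph induced by the neighbors of $x$. A graph is contractible if it is the one-vertex graph $K_1$, or if it has a vertex $x$ such that both $G-x$ (delete $x$ and its edges) and $S(x)$ are contractible. A 2-sphere is a finite simple graph in which every unit sphere is a cyclic graph $C_n$ with $n\ge 4$ and such that there is a vertex $x$ with $G-x$ contractible. A 2-ball is a graph of the form $H-x$ where $H$ is a 2-sphere and $x$ a vertex of $H$. The boundary of a 2-ball consists of the vertices whose unit sphere is a path graph (rather than a cycle); these form a cyclic graph (the boundary circle), whose number of edges is the boundary length. An edge $(a,b)$ is interior if not both $a$ and $b$ lie on the boundary. An edge refinement at an edge $(a,b)$ of a graph $(V,E)$ produces the graph with vertex set $V\cup\{c\}$ ($c$ new) and edge set $(E\setminus\{(a,b)\})\cup\{(a,c),(c,b)\}\cup\{(c,u): u\in S(a)\cap S(b)\}$; in a sequence of refinements, "interior edge" refers to the current graph, whose boundary circle is unchanged. *)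

theory Defs
  imports "Graph_Theory.Graph_Theory" "HOL-Library.Infinite_Typeclass"
begin

text \<open>
  A finite simple graph is a \<^emph>\<open>graph\<close> in the sense of Graph-Theory: finite, without loops or
  parallel arcs, and symmetric. An undirected edge is thus a pair of opposite arcs, and the degree of
  a vertex is its \<^const>\<open>out_degree\<close>.
\<close>

definition cycle_graph :: "nat \<Rightarrow> nat pair_pre_digraph" where
  "cycle_graph n = \<lparr> pverts = {..<n},
     parcs = {(i, j). i < n \<and> j < n \<and> (j = Suc i mod n \<or> i = Suc j mod n)} \<rparr>"

definition path_graph :: "nat \<Rightarrow> nat pair_pre_digraph" where
  "path_graph n = \<lparr> pverts = {..<n},
     parcs = {(i, j). i < n \<and> j < n \<and> (j = Suc i \<or> i = Suc j)} \<rparr>"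

definition is_cyclic_graph :: "nat \<Rightarrow> ('a, 'b) pre_digraph \<Rightarrow> bool" where
  "is_cyclic_graph n G \<longleftrightarrow> 3 \<le> n \<and> digraph_iso (with_proj (cycle_graph n)) G"

definition is_path_graph :: "nat \<Rightarrow> ('a, 'b) pre_digraph \<Rightarrow> bool" where
  "is_path_graph n G \<longleftrightarrow> 1 \<le> n \<and> digraph_iso (with_proj (path_graph n)) G"

definition unit_sphere :: "('a, 'b) pre_digraph \<Rightarrow> 'a \<Rightarrow> ('a, 'b) pre_digraph" where
  "unit_sphere G x = G \<restriction> {y. x \<rightarrow>\<^bsub>G\<^esub> y}"

inductive contractible :: "('a, 'b) pre_digraph \<Rightarrow> bool" where
  K1: "K\<^bsub>1\<^esub> G \<Longrightarrow> contractible G"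
| step: "graph G \<Longrightarrow> x \<in> verts G \<Longrightarrow> contractible (pre_digraph.del_vert G x) \<Longrightarrow>
    contractible (unit_sphere G x) \<Longrightarrow> contractible G"

definition two_sphere :: "('a, 'b) pre_digraph \<Rightarrow> bool" where
  "two_sphere G \<longleftrightarrow> graph G \<and>
     (\<forall>x \<in> verts G. \<exists>n \<ge> 4. is_cyclic_graph n (unit_sphere G x)) \<and>
     (\<exists>x \<in> verts G. contractible (pre_digraph.del_vert G x))"

definition two_ball :: "('a, 'b) pre_digraph \<Rightarrow> bool" where
  "two_ball G \<longleftrightarrow> (\<exists>H x. two_sphere H \<and> x \<in> verts H \<and> G = pre_digraph.del_vert H x)"

definition boundary_verts :: "('a, 'b) pre_digraph \<Rightarrow> 'a set" where
  "boundary_verts G = {v \<in> verts G. \<exists>n. is_path_graph n (unit_sphere G v)}"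

definition boundary_graph :: "('a, 'b) pre_digraph \<Rightarrow> ('a, 'b) pre_digraph" where
  "boundary_graph G = G \<restriction> boundary_verts G"

definition interior_edge :: "('a, 'b) pre_digraph \<Rightarrow> 'a \<Rightarrow> 'a \<Rightarrow> bool" where
  "interior_edge G a b \<longleftrightarrow> a \<rightarrow>\<^bsub>G\<^esub> b \<and> \<not> (a \<in> boundary_verts G \<and> b \<in> boundary_verts G)"

definition edge_refinement ::
    "'a pair_pre_digraph \<Rightarrow> 'a \<Rightarrow> 'a \<Rightarrow> 'a \<Rightarrow> 'a pair_pre_digraph" where
  "edge_refinement G a b c =
     (let W = verts (unit_sphere (with_proj G) a) \<inter> verts (unit_sphere (with_proj G) b)
      in \<lparr> pverts = pverts G \<union> {c},
           parcs = (parcs G - {(a, b), (b, a)}) \<union> {(a, c), (c, a), (c, b), (b, c)}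
                   \<union> {c} \<times> W \<union> W \<times> {c} \<rparr>)"

definition interior_refinement :: "'a pair_pre_digraph \<Rightarrow> 'a pair_pre_digraph \<Rightarrow> bool" where
  "interior_refinement G G' \<longleftrightarrow>
     (\<exists>a b c. interior_edge (with_proj G) a b \<and> c \<notin> pverts G \<and> G' = edge_refinement G a b c)"

end

(* Over F_2, the edges of a graph with even degrees form a 1-cycle. A disk has trivial first homology,
   so this cycle bounds a set S of triangles. Every edge then lies on exactly one triangle of S, and
   every interior edge on exactly one triangle outside S, so both the number of edges and the number
   of interior edges are divisible by 3, hence so is their difference L. Homology vanishes because
   contractible graphs are built by coning off connected links; this is inherited by the sphere and
   by the sphere minus any vertex, and it survives refinement.

   Conversely, if 3 divides L, colour the boundary circle periodically with three colours and the
   interior vertices arbitrarily. Monochromatic edges are interior and can be removed one at a time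
   by refinements. In the resulting properly 3-coloured disk every link is 2-coloured, and the two
   boundary neighbours of a boundary vertex have different colours, so all degrees are even. *)

theory Submission
  imports Defs
begin

text \<open>The definition of a sphere provides one contractible complement H - x, whereas the ball
  is H - y for an arbitrary vertex y, and contractibility is not visibly inherited by H - y or by
  its refinements. Vanishing F_2-homology is weaker and moves more easily: from H - x to H by coning
  over the link of x, from H to H - y by replacing a 2-chain by its complement if necessary, and
  through a refinement by exchanging faces across tetrahedra. No planarity or Jordan curve argument
  is then required; what remains of the surface structure is local, namely the number of common
  neighbours of adjacent vertices, the absence of K_4, and the path links of boundary
  vertices.\<close>

section \<open>Chains over the field with two elements\<close>

text \<open>A 1-chain is a symmetric relation, a 2-chain a set of triangles. \<open>acyclic0\<close> and \<open>acyclic1\<close>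
  express the vanishing of the reduced homology of the clique complex in degrees 0 and 1.\<close>

definition triangles :: "'a rel \<Rightarrow> 'a set set" where
  "triangles E = {t. card t = 3 \<and> (\<forall>x\<in>t. \<forall>y\<in>t. x \<noteq> y \<longrightarrow> (x, y) \<in> E)}"

definition face_boundary :: "'a set set \<Rightarrow> 'a rel" where
  "face_boundary S = {(x, y). x \<noteq> y \<and> odd (card {t \<in> S. x \<in> t \<and> y \<in> t})}"

definition even_degrees :: "'a rel \<Rightarrow> bool" where
  "even_degrees D \<longleftrightarrow> (\<forall>v. even (card (D `` {v})))"

definition acyclic0 :: "'a set \<Rightarrow> 'a rel \<Rightarrow> bool" where
  "acyclic0 X E \<longleftrightarrow> (\<forall>A \<subseteq> X. even (card A) \<longrightarrow>
     (\<exists>D \<subseteq> E \<inter> X \<times> X. sym D \<and> {v. odd (card (D `` {v}))} = A))"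

definition acyclic1 :: "'a rel \<Rightarrow> bool" where
  "acyclic1 E \<longleftrightarrow> (\<forall>D \<subseteq> E. sym D \<longrightarrow> even_degrees D \<longrightarrow>
     (\<exists>S \<subseteq> triangles E. face_boundary S = D))"

section \<open>Parity of symmetric differences; triangles and their boundaries\<close>

lemma even_card_sym_diff:
  assumes "finite A" "finite B"
  shows "even (card (sym_diff A B)) \<longleftrightarrow> (even (card A) \<longleftrightarrow> even (card B))"
proof -
  have "card (sym_diff A B) + 2 * card (A \<inter> B) = card A + card B"
  proof -
    have "card (sym_diff A B) = card (A - B) + card (B - A)"
      using assms by (intro card_Un_disjoint) auto
    moreover have "card A = card (A - B) + card (A \<inter> B)"
      using assms by (metis Diff_Diff_Int Diff_disjoint Int_commute Un_Diff_Int card_Un_disjoint finite_Diff finite_Int Int_Diff_disjoint)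
    moreover have "card B = card (B - A) + card (A \<inter> B)"
      using assms by (metis Int_commute Un_Diff_Int card_Un_disjoint finite_Diff finite_Int Int_Diff_disjoint)
    ultimately show ?thesis by simp
  qed
  then show ?thesis by presburger
qed

lemma sym_diff_Image: "sym_diff D D' `` {v} = sym_diff (D `` {v}) (D' `` {v})"
  by auto

lemma odd_degrees_sym_diff:
  assumes "finite D" "finite D'"
  shows "{v. odd (card (sym_diff D D' `` {v}))} =
    sym_diff {v. odd (card (D `` {v}))} {v. odd (card (D' `` {v}))}"
  using assms by (auto simp: sym_diff_Image even_card_sym_diff finite_Image)

lemma even_degrees_sym_diff:
  assumes "finite D" "finite D'" "even_degrees D" "even_degrees D'"
  shows "even_degrees (sym_diff D D')"
  using assms unfolding even_degrees_def sym_diff_Image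
  by (simp add: even_card_sym_diff finite_Image)

lemma triangles_subset_Pow_Field: "triangles E \<subseteq> Pow (Field E)"
proof
  fix t assume t: "t \<in> triangles E"
  have "x \<in> Field E" if "x \<in> t" for x
  proof -
    have "card t = 3" using t by (simp add: triangles_def)
    then have "\<not> t \<subseteq> {x}" using card_mono[of "{x}" t] by auto
    then obtain y where "y \<in> t" "x \<noteq> y" by blast
    with t that have "(x, y) \<in> E" by (auto simp: triangles_def)
    then show ?thesis by (auto simp: Field_def)
  qed
  then show "t \<in> Pow (Field E)" by blast
qed

lemma finite_triangles: "finite E \<Longrightarrow> finite (triangles E)"
  by (meson finite_Field finite_Pow_iff finite_subset triangles_subset_Pow_Field)

lemma triangles_mono: "E \<subseteq> F \<Longrightarrow> triangles E \<subseteq> triangles F"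
  by (auto simp: triangles_def)

lemma triangleI:
  assumes "sym E" "irrefl E" "(x, y) \<in> E" "(y, z) \<in> E" "(x, z) \<in> E"
  shows "{x, y, z} \<in> triangles E"
proof -
  have "x \<noteq> y" "y \<noteq> z" "x \<noteq> z" using assms by (auto simp: irrefl_def)
  then show ?thesis using assms by (auto simp: triangles_def dest: symD)
qed

lemma triangleE:
  assumes "t \<in> triangles E" "x \<in> t" "y \<in> t" "x \<noteq> y"
  obtains z where "t = {x, y, z}" "z \<noteq> x" "z \<noteq> y" "(x, y) \<in> E" "(x, z) \<in> E" "(y, z) \<in> E"
proof -
  have c: "card t = 3" using assms by (simp add: triangles_def)
  then have "finite t" by (simp add: card_ge_0_finite)
  then have "card (t - {x, y}) = 1" using c assms by (simp add: card_Diff_subset)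
  then obtain z where "t - {x, y} = {z}" by (meson card_1_singletonE)
  then have "t = {x, y, z}" "z \<noteq> x" "z \<noteq> y" using assms by auto
  then show thesis using that assms by (auto simp: triangles_def)
qed

lemma sym_face_boundary: "sym (face_boundary S)"
  by (auto simp: sym_def face_boundary_def conj_commute)

lemma face_boundary_subset: "S \<subseteq> triangles E \<Longrightarrow> face_boundary S \<subseteq> E"
  unfolding face_boundary_def
proof clarsimp
  fix x y assume "S \<subseteq> triangles E" "x \<noteq> y" "odd (card {t \<in> S. x \<in> t \<and> y \<in> t})"
  then have "{t \<in> S. x \<in> t \<and> y \<in> t} \<noteq> {}" by force
  then obtain t where "t \<in> S" "x \<in> t" "y \<in> t" by blast
  with \<open>S \<subseteq> triangles E\<close> \<open>x \<noteq> y\<close> show "(x, y) \<in> E" by (auto simp: triangles_def)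
qed

lemma face_boundary_sym_diff:
  assumes "finite S" "finite T"
  shows "face_boundary (sym_diff S T) = sym_diff (face_boundary S) (face_boundary T)"
proof -
  have "{t \<in> sym_diff S T. x \<in> t \<and> y \<in> t} =
      sym_diff {t \<in> S. x \<in> t \<and> y \<in> t} {t \<in> T. x \<in> t \<and> y \<in> t}" for x y
    by auto
  then have "odd (card {t \<in> sym_diff S T. x \<in> t \<and> y \<in> t}) \<longleftrightarrow>
      (odd (card {t \<in> S. x \<in> t \<and> y \<in> t}) \<noteq> odd (card {t \<in> T. x \<in> t \<and> y \<in> t}))" for x y
    using assms by (simp add: even_card_sym_diff)
  then show ?thesis by (auto simp: face_boundary_def)
qed

lemma face_boundary_empty: "face_boundary {} = {}"
  by (simp add: face_boundary_def)

lemma face_boundary_singleton: "face_boundary {t} = {(x, y). x \<in> t \<and> y \<in> t \<and> x \<noteq> y}"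
proof -
  have "{s \<in> {t}. x \<in> s \<and> y \<in> s} = (if x \<in> t \<and> y \<in> t then {t} else {})" for x y
    by auto
  then show ?thesis by (auto simp: face_boundary_def split: if_splits)
qed

lemma face_boundary_insert:
  assumes "finite S" "t \<notin> S"
  shows "face_boundary (insert t S) = sym_diff (face_boundary S) {(x, y). x \<in> t \<and> y \<in> t \<and> x \<noteq> y}"
proof -
  have "insert t S = sym_diff S {t}" using assms by auto
  then show ?thesis using assms face_boundary_sym_diff[of S "{t}"]
    by (simp add: face_boundary_singleton)
qed

text \<open>A boundary has no boundary: a single triangle gives degree 2 to each of its corners, and
  symmetric differences preserve even degrees.\<close>

lemma even_degrees_face_boundary:
  assumes "finite S" "\<And>t. t \<in> S \<Longrightarrow> card t = 3"
  shows "even_degrees (face_boundary S)"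
proof -
  have "finite (face_boundary S) \<and> even_degrees (face_boundary S)"
    using assms
  proof (induction S rule: finite_induct)
    case empty
    then show ?case by (simp add: face_boundary_empty even_degrees_def)
  next
    case (insert t S)
    let ?K = "{(x, y). x \<in> t \<and> y \<in> t \<and> x \<noteq> y}"
    have t: "card t = 3" "finite t" using insert by (auto simp: card_ge_0_finite)
    have "finite ?K" by (rule finite_subset[of _ "t \<times> t"]) (use t in auto)
    moreover have "even_degrees ?K"
      unfolding even_degrees_def
    proof
      fix v
      have "?K `` {v} = (if v \<in> t then t - {v} else {})" by auto
      then show "even (card (?K `` {v}))" using t by simp
    qed
    ultimately show ?case
      using insert by (simp add: face_boundary_insert even_degrees_sym_diff)
  qed
  then show ?thesis ..
qed

lemma acyclic0E:
  assumes "acyclic0 X E" "A \<subseteq> X" "even (card A)"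
  obtains D where "D \<subseteq> E \<inter> X \<times> X" "sym D" "{v. odd (card (D `` {v}))} = A"
  using assms(1)[unfolded acyclic0_def, rule_format, OF assms(2,3)] by auto

lemma acyclic1E:
  assumes "acyclic1 E" "D \<subseteq> E" "sym D" "even_degrees D"
  obtains S where "S \<subseteq> triangles E" "face_boundary S = D"
  using assms(1)[unfolded acyclic1_def, rule_format, OF assms(2-4)] by auto

section \<open>Connectivity and coning\<close>

lemma acyclic0_singleton: "acyclic0 {x} E"
proof -
  have "A = {}" if "A \<subseteq> {x}" "even (card A)" for A
    using that subset_singletonD by fastforce
  then show ?thesis unfolding acyclic0_def
    by (metis (no_types, lifting) Collect_empty_eq Image_empty1 card.empty empty_subsetI even_zero sym_def empty_iff)
qed

text \<open>\<open>acyclic0\<close> is connectivity in chain form: every even set of vertices can be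
  paired up by paths. An odd degree prescribed at the new vertex \<open>x\<close> can be shifted to
  \<open>y\<close> along their common edge.\<close>

lemma acyclic0_insert:
  assumes X: "acyclic0 X E" "finite X" and y: "y \<in> X" "(x, y) \<in> E" and E: "sym E"
  shows "acyclic0 (insert x X) E"
proof (cases "x \<in> X")
  case True
  then show ?thesis using X by (simp add: insert_absorb)
next
  case False
  show ?thesis unfolding acyclic0_def
  proof (intro allI impI)
    fix A assume A: "A \<subseteq> insert x X" "even (card A)"
    have fA: "finite A" using A X finite_subset by auto
    show "\<exists>D\<subseteq>E \<inter> insert x X \<times> insert x X. sym D \<and> {v. odd (card (D `` {v}))} = A"
    proof (cases "x \<in> A")
      case False
      then have "A \<subseteq> X" using A by auto
      then obtain D where "D \<subseteq> E \<inter> X \<times> X" "sym D" "{v. odd (card (D `` {v}))} = A"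
        using acyclic0E[OF X(1)] A by metis
      then show ?thesis by (intro exI[of _ D]) auto
    next
      case True
      define P where "P = {(x, y), (y, x)}"
      have xy: "x \<noteq> y" using y False by auto
      have P: "{v. odd (card (P `` {v}))} = {x, y}"
      proof -
        have "P `` {v} = (if v = x then {y} else if v = y then {x} else {})" for v
          using xy by (auto simp: P_def)
        then show ?thesis by (auto split: if_splits)
      qed
      \<comment> \<open>Toggling both \<open>x\<close> and \<open>y\<close> keeps the set even and
        moves it into \<open>X\<close>; adding the edge \<open>P\<close> afterwards toggles them
        back.\<close>
      define A' where "A' = sym_diff A {x, y}"
      have "even (card A')" unfolding A'_def using A fA xy by (subst even_card_sym_diff) auto
      moreover have "A' \<subseteq> X" using A True y by (auto simp: A'_def)
      ultimately obtain D where D: "D \<subseteq> E \<inter> X \<times> X" "sym D" "{v. odd (card (D `` {v}))} = A'"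
        using acyclic0E[OF X(1)] by metis
      have fD: "finite D" using D X by (meson finite_SigmaI finite_subset le_inf_iff)
      have "{v. odd (card (sym_diff D P `` {v}))} = sym_diff A' {x, y}"
        using fD D P by (subst odd_degrees_sym_diff) (auto simp: P_def)
      also have "\<dots> = A" by (auto simp: A'_def)
      finally have "{v. odd (card (sym_diff D P `` {v}))} = A" .
      moreover have "sym (sym_diff D P)" using D(2) by (auto simp: P_def sym_def)
      moreover have "sym_diff D P \<subseteq> E \<inter> insert x X \<times> insert x X"
        using D y E by (auto simp: P_def dest: symD)
      ultimately show ?thesis by (intro exI[of _ "sym_diff D P"]) simp
    qed
  qed
qed

text \<open>Coning off a 1-chain of the link whose boundary consists of the edges of a cycle at \<open>x\<close>
  pushes the cycle off \<open>x\<close>.\<close>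

lemma acyclic1_if_acyclic1_del:
  assumes E: "finite E" "sym E" "irrefl E"
    and link: "acyclic0 (E `` {x}) E"
    and del: "acyclic1 (E \<inter> (- {x}) \<times> (- {x}))"
  shows "acyclic1 E"
  unfolding acyclic1_def
proof (intro allI impI)
  fix D assume D: "D \<subseteq> E" "sym D" "even_degrees D"
  let ?N = "E `` {x}"
  \<comment> \<open>Evenness of \<open>D\<close> at \<open>x\<close> is what allows its neighbours
    there to be the odd set of a chain \<open>P\<close> in the link.\<close>
  have "D `` {x} \<subseteq> ?N" "even (card (D `` {x}))"
    using D by (auto simp: even_degrees_def)
  then obtain P where P: "P \<subseteq> E \<inter> ?N \<times> ?N" "sym P" "{v. odd (card (P `` {v}))} = D `` {x}"
    using acyclic0E[OF link] by metis
  have fP: "finite P" using P E by (meson finite_subset le_inf_iff)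
  have xP: "(x, w) \<notin> P" "(w, x) \<notin> P" for w
    using P E by (auto simp: irrefl_def)
  define S where "S = (\<lambda>(u, w). {x, u, w}) ` P"
  have fS: "finite S" using fP by (simp add: S_def)
  have S: "S \<subseteq> triangles E" using P E by (auto simp: S_def intro!: triangleI)
  have bd: "(x, u) \<in> face_boundary S \<longleftrightarrow> (x, u) \<in> D" for u
  proof (cases "u = x")
    case True
    then show ?thesis using D E by (auto simp: face_boundary_def irrefl_def)
  next
    case False
    \<comment> \<open>Faces of the cone on the edge \<open>xu\<close> correspond to edges of
      \<open>P\<close> at \<open>u\<close>. Hence the boundary of \<open>S\<close> agrees with
      \<open>D\<close> at \<open>x\<close>, and their sum \<open>D'\<close> avoids
      \<open>x\<close>.\<close>
    have "{t \<in> S. x \<in> t \<and> u \<in> t} = (\<lambda>w. {x, u, w}) ` (P `` {u})"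
    proof (intro equalityI subsetI)
      fix t assume "t \<in> {t \<in> S. x \<in> t \<and> u \<in> t}"
      then obtain v w where "(v, w) \<in> P" "t = {x, v, w}" "u = v \<or> u = w"
        using False by (auto simp: S_def)
      then show "t \<in> (\<lambda>w. {x, u, w}) ` (P `` {u})"
        using P(2) by (auto simp: insert_commute dest: symD)
    qed (auto simp: S_def)
    moreover have "inj_on (\<lambda>w. {x, u, w}) (P `` {u})"
    proof (rule inj_onI)
      fix w w' assume "w \<in> P `` {u}" "w' \<in> P `` {u}" "{x, u, w} = {x, u, w'}"
      moreover have "w \<noteq> x" "w' \<noteq> x" "w \<noteq> u" "w' \<noteq> u"
        using calculation P E xP by (auto simp: irrefl_def)
      ultimately show "w = w'" by auto
    qed
    ultimately have "card {t \<in> S. x \<in> t \<and> u \<in> t} = card (P `` {u})" by (simp add: card_image)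
    then show ?thesis using False P(3) by (auto simp: face_boundary_def)
  qed
  define D' where "D' = sym_diff D (face_boundary S)"
  have fbE: "face_boundary S \<subseteq> E" using S by (rule face_boundary_subset)
  have "(x, u) \<notin> D'" "(u, x) \<notin> D'" for u
    using bd[of u] D(2) sym_face_boundary[of S] by (auto simp: D'_def dest: symD)
  moreover have "D' \<subseteq> E" using D fbE by (auto simp: D'_def)
  ultimately have "D' \<subseteq> E \<inter> (- {x}) \<times> (- {x})" by auto
  moreover have "sym D'" unfolding D'_def using D(2) sym_face_boundary[of S] by (auto simp: sym_def)
  moreover have "even_degrees D'"
    unfolding D'_def
  proof (rule even_degrees_sym_diff)
    show "finite D" "finite (face_boundary S)" using D fbE E finite_subset by auto
    show "even_degrees (face_boundary S)"
      using fS S by (auto simp: triangles_def intro: even_degrees_face_boundary)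
  qed (rule D)
  ultimately obtain S' where S': "S' \<subseteq> triangles (E \<inter> (- {x}) \<times> (- {x}))" "face_boundary S' = D'"
    using acyclic1E[OF del] by metis
  have S'E: "S' \<subseteq> triangles E" using S' triangles_mono by (metis Int_lower1 order_trans)
  have "finite S'" using S'E E finite_triangles finite_subset by blast
  then have "face_boundary (sym_diff S' S) = D"
    using fS S' by (subst face_boundary_sym_diff) (auto simp: D'_def)
  then show "\<exists>S\<subseteq>triangles E. face_boundary S = D"
    using S S'E by (intro exI[of _ "sym_diff S' S"]) auto
qed

section \<open>Cycles, paths and links\<close>

text \<open>Only pairs inside \<open>N\<close> are constrained, so a link can be described by the
  ambient edge relation instead of an induced one.\<close>

definition cycle_on :: "nat \<Rightarrow> (nat \<Rightarrow> 'a) \<Rightarrow> 'a set \<Rightarrow> 'a rel \<Rightarrow> bool" where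
  "cycle_on n p N E \<longleftrightarrow> inj_on p {..<n} \<and> N = p ` {..<n} \<and>
     (\<forall>i<n. \<forall>j<n. (p i, p j) \<in> E \<longleftrightarrow> j = Suc i mod n \<or> i = Suc j mod n)"

text \<open>A list rather than an indexing function, because a refinement may insert a new vertex
  into the middle of the link of a boundary vertex.\<close>

definition path_list :: "'a list \<Rightarrow> 'a set \<Rightarrow> 'a rel \<Rightarrow> bool" where
  "path_list xs N E \<longleftrightarrow> distinct xs \<and> set xs = N \<and>
     (\<forall>i<length xs. \<forall>j<length xs. (xs ! i, xs ! j) \<in> E \<longleftrightarrow> j = Suc i \<or> i = Suc j)"

text \<open>Arcs of \<open>K\<close> may be abstract labels, so the isomorphism is read off on
  \<open>arcs_ends\<close>, where the vertex map alone decides adjacency.\<close>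

lemma digraph_isoD:
  assumes "digraph_iso (with_proj P) K"
  obtains p where "inj_on p (pverts P)" "verts K = p ` pverts P"
    "\<And>i j. i \<in> pverts P \<Longrightarrow> j \<in> pverts P \<Longrightarrow> (p i, p j) \<in> arcs_ends K \<longleftrightarrow> (i, j) \<in> parcs P"
proof -
  obtain f where f: "pre_digraph.digraph_isomorphism (with_proj P) f" "K = app_iso f (with_proj P)"
    using assms by (auto simp: digraph_iso_def)
  have wf: "wf_digraph (with_proj P)" and inj: "inj_on (iso_verts f) (pverts P)"
    using f(1) by (auto simp: pre_digraph.digraph_isomorphism_def)
  have ends: "arcs_ends K = map_prod (iso_verts f) (iso_verts f) ` parcs P"
    using f unfolding pre_digraph.digraph_isomorphism_def arcs_ends_conv
    by (force simp: image_image)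
  show thesis
  proof (rule that[of "iso_verts f"])
    fix i j assume "i \<in> pverts P" "j \<in> pverts P"
    moreover have "k \<in> pverts P \<and> l \<in> pverts P" if "(k, l) \<in> parcs P" for k l
      using wf_digraph.tail_in_verts[OF wf, of "(k, l)"] wf_digraph.head_in_verts[OF wf, of "(k, l)"] that
      by simp
    ultimately show "(iso_verts f i, iso_verts f j) \<in> arcs_ends K \<longleftrightarrow> (i, j) \<in> parcs P"
      unfolding ends using inj_onD[OF inj] by (smt (verit) image_iff map_prod_simp prod.inject surj_pair)
  qed (use inj f(2) in simp_all)
qed

text \<open>For pair digraphs an arc is its pair of ends, so the vertex map also determines the arc
  map.\<close>

lemma digraph_isoI:
  assumes "inj_on p (pverts P)" "pverts Q = p ` pverts P"
    and "\<And>i j. i \<in> pverts P \<Longrightarrow> j \<in> pverts P \<Longrightarrow> (p i, p j) \<in> parcs Q \<longleftrightarrow> (i, j) \<in> parcs P"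
    and P: "parcs P \<subseteq> pverts P \<times> pverts P" and Q: "parcs Q \<subseteq> pverts Q \<times> pverts Q"
  shows "digraph_iso (with_proj P) (with_proj Q)"
proof -
  let ?f = "\<lparr>iso_verts = p, iso_arcs = map_prod p p, iso_head = snd, iso_tail = fst\<rparr>"
  have "inj_on (map_prod p p) (pverts P \<times> pverts P)"
    using assms(1) by (rule map_prod_inj_on) (rule assms(1))
  then have "inj_on (map_prod p p) (parcs P)" using P by (rule inj_on_subset)
  moreover have "wf_digraph (with_proj P)" using P by unfold_locales auto
  ultimately have "pre_digraph.digraph_isomorphism (with_proj P) ?f"
    using assms(1) by (auto simp: pre_digraph.digraph_isomorphism_def)
  moreover have "map_prod p p ` parcs P = parcs Q"
  proof (intro equalityI subsetI)
    fix e assume "e \<in> map_prod p p ` parcs P"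
    then show "e \<in> parcs Q" using assms(3) P by auto
  next
    fix e assume e: "e \<in> parcs Q"
    then obtain i j where "i \<in> pverts P" "j \<in> pverts P" "e = (p i, p j)"
      using Q unfolding assms(2) by auto
    then show "e \<in> map_prod p p ` parcs P" using e assms(3) by (auto intro: rev_image_eqI)
  qed
  then have "with_proj Q = app_iso ?f (with_proj P)"
    using assms(2) by (simp add: app_iso_def with_proj_def)
  ultimately show ?thesis by (auto simp: digraph_iso_def)
qed

lemma is_cyclic_graphD:
  assumes "is_cyclic_graph n K"
  obtains p where "3 \<le> n" "cycle_on n p (verts K) (arcs_ends K)"
proof -
  have n: "3 \<le> n" and "digraph_iso (with_proj (cycle_graph n)) K"
    using assms by (auto simp: is_cyclic_graph_def)
  from this(2) obtain p where "inj_on p {..<n}" "verts K = p ` {..<n}"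
    "\<And>i j. i < n \<Longrightarrow> j < n \<Longrightarrow> (p i, p j) \<in> arcs_ends K \<longleftrightarrow> (i, j) \<in> parcs (cycle_graph n)"
    by (rule digraph_isoD) (auto simp: cycle_graph_def)
  then have "cycle_on n p (verts K) (arcs_ends K)"
    by (auto simp: cycle_on_def cycle_graph_def)
  with n show thesis by (rule that)
qed

section \<open>Links and deletions as relations; homology of contractible graphs\<close>

lemma arcs_ends_induce: "arcs_ends (G \<restriction> X) = arcs_ends G \<inter> X \<times> X"
  by (auto simp: arcs_ends_conv)

lemma arcs_ends_del_vert: "arcs_ends (pre_digraph.del_vert G x) = arcs_ends G \<inter> (- {x}) \<times> (- {x})"
  by (auto simp: arcs_ends_conv pre_digraph.del_vert_simps)

lemma verts_unit_sphere: "verts (unit_sphere G x) = arcs_ends G `` {x}"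
  by (auto simp: unit_sphere_def)

lemma arcs_ends_unit_sphere:
  "arcs_ends (unit_sphere G x) = arcs_ends G \<inter> (arcs_ends G `` {x}) \<times> (arcs_ends G `` {x})"
  by (auto simp: unit_sphere_def arcs_ends_induce)

lemma acyclic0_restrict: "acyclic0 X (E \<inter> X \<times> X) \<longleftrightarrow> acyclic0 X E"
  by (simp add: acyclic0_def Int_assoc)

lemma cycle_on_restrict: "cycle_on n p N (E \<inter> N \<times> N) \<longleftrightarrow> cycle_on n p N E"
  by (auto simp: cycle_on_def)

lemma graph_arcs_ends:
  assumes "graph G"
  shows "finite (arcs_ends G)" "sym (arcs_ends G)" "irrefl (arcs_ends G)"
    "arcs_ends G \<subseteq> verts G \<times> verts G" "finite (verts G)"
proof -
  interpret graph G by fact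
  show "finite (arcs_ends G)" "finite (verts G)" by (simp_all add: arcs_ends_conv)
  show "sym (arcs_ends G)" using sym_arcs by (simp add: symmetric_def)
  show "irrefl (arcs_ends G)" using no_loops by (auto simp: irrefl_def arcs_ends_conv)
  show "arcs_ends G \<subseteq> verts G \<times> verts G" by (auto simp: arcs_ends_conv)
qed

text \<open>Induction along the vertex removals. The link of the vertex put back is contractible,
  hence connected, as coning requires. Nonemptiness is carried along because in degree 0 that vertex
  needs a neighbour to be attached to.\<close>

lemma contractible_acyclic:
  assumes "contractible G"
  shows "verts G \<noteq> {} \<and> acyclic0 (verts G) (arcs_ends G) \<and> acyclic1 (arcs_ends G)"
  using assms
proof (induction rule: contractible.induct)
  case (K1 G)
  then obtain x where "verts G = {x}" by (auto simp: complete_digraph_def card_1_singleton_iff)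
  moreover from this have "arcs_ends G = {}" using K1 by (auto simp: complete_digraph_def)
  moreover have "acyclic1 {}" by (auto simp: acyclic1_def face_boundary_empty)
  ultimately show ?case by (simp add: acyclic0_singleton)
next
  case (step G x)
  note G = graph_arcs_ends[OF \<open>graph G\<close>]
  let ?E = "arcs_ends G"
  have link: "?E `` {x} \<noteq> {}" "acyclic0 (?E `` {x}) ?E"
    using step by (auto simp: verts_unit_sphere arcs_ends_unit_sphere acyclic0_restrict)
  then obtain y where y: "(x, y) \<in> ?E" by auto
  have "acyclic1 (?E \<inter> (- {x}) \<times> (- {x}))" using step by (simp add: arcs_ends_del_vert)
  with G link have "acyclic1 ?E" by (blast intro: acyclic1_if_acyclic1_del)
  moreover have "acyclic0 (verts G) ?E"
  proof -
    have "?E \<inter> (- {x}) \<times> (- {x}) = ?E \<inter> (verts G - {x}) \<times> (verts G - {x})"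
      using G(4) by auto
    then have "acyclic0 (verts G - {x}) ?E"
      using step.IH(1) by (simp add: arcs_ends_del_vert pre_digraph.verts_del_vert acyclic0_restrict)
    then have "acyclic0 (insert x (verts G - {x})) ?E"
      using y G by (intro acyclic0_insert[of _ _ y]) (auto simp: irrefl_def)
    then show ?thesis using step.hyps by (simp add: insert_absorb)
  qed
  ultimately show ?case using step.hyps by auto
qed

section \<open>Combinatorics of cycles as links\<close>

lemma cycle_on_neighbours:
  assumes p: "cycle_on n p N E" "3 \<le> n" and i: "i < n"
  obtains k where "k < n" "Suc k mod n = i" "p (Suc i mod n) \<noteq> p k" "E `` {p i} \<inter> N = {p (Suc i mod n), p k}"
proof -
  \<comment> \<open>The predecessor of \<open>i\<close> modulo \<open>n\<close>.\<close>
  define k where "k = (if i = 0 then n - 1 else i - 1)"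
  have k: "i = Suc j mod n \<longleftrightarrow> j = k" if "j < n" for j
    using i that p(2) by (auto simp: k_def mod_Suc)
  have ne: "Suc i mod n \<noteq> k" using i p(2) by (auto simp: k_def mod_Suc)
  have lt: "k < n" "Suc i mod n < n" using i p(2) by (auto simp: k_def)
  have "p (Suc i mod n) \<noteq> p k"
    using ne lt p by (auto simp: cycle_on_def inj_on_def)
  moreover have "E `` {p i} \<inter> N = {p (Suc i mod n), p k}"
    using p i lt k by (auto simp: cycle_on_def)
  ultimately show thesis using that[of k] k[of k] lt by auto
qed

lemma cycle_on_card_neighbours:
  assumes p: "cycle_on n p N E" "3 \<le> n" and x: "x \<in> N"
  shows "card (E `` {x} \<inter> N) = 2"
proof -
  obtain i where i: "i < n" "x = p i" using p x by (auto simp: cycle_on_def)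
  then show ?thesis using cycle_on_neighbours[OF p i(1)] by (metis card_2_iff)
qed

text \<open>Three mutually adjacent positions are pairwise consecutive modulo \<open>n\<close>,
  which forces \<open>n = 3\<close>.\<close>

lemma cycle_on_triangle_free:
  assumes p: "cycle_on n p N E" "4 \<le> n"
    and xyz: "x \<in> N" "y \<in> N" "z \<in> N" "(x, y) \<in> E" "(y, z) \<in> E" "(x, z) \<in> E"
  shows False
proof -
  obtain i j k where ijk: "i < n" "j < n" "k < n" "x = p i" "y = p j" "z = p k"
    using p xyz by (auto simp: cycle_on_def)
  then have "j = Suc i mod n \<or> i = Suc j mod n" "k = Suc j mod n \<or> j = Suc k mod n"
    "k = Suc i mod n \<or> i = Suc k mod n"
    using p xyz by (auto simp: cycle_on_def)
  then show False
    using ijk(1-3) p(2) by (auto simp: mod_Suc split: if_splits)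
qed

text \<open>When the vertices are added in cyclic order, each one is attached to its
  predecessor.\<close>

lemma acyclic0_cycle_on:
  assumes p: "cycle_on n p N E" "3 \<le> n" and E: "sym E"
  shows "acyclic0 N E"
proof -
  have "acyclic0 (p ` {..<Suc k}) E" if "k < n" for k
    using that
  proof (induction k)
    case 0
    then show ?case by (simp add: lessThan_Suc acyclic0_singleton)
  next
    case (Suc k)
    have "(p (Suc k), p k) \<in> E"
      using p Suc.prems by (auto simp: cycle_on_def)
    then have "acyclic0 (insert (p (Suc k)) (p ` {..<Suc k})) E"
      using Suc E by (intro acyclic0_insert[of _ _ "p k"]) auto
    then show ?case by (simp add: lessThan_Suc)
  qed
  from this[of "n - 1"] show ?thesis using p by (simp add: cycle_on_def)
qed

lemma cycle_on_rotate:
  assumes p: "cycle_on n p N E" and n: "0 < n"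
  shows "cycle_on n (\<lambda>i. p ((i + k) mod n)) N E"
proof -
  have eq: "(i + k) mod n = (j + k) mod n \<longleftrightarrow> i mod n = j mod n" for i j
  proof
    assume eq: "(i + k) mod n = (j + k) mod n"
    \<comment> \<open>\<open>(n - 1) * k\<close> is the additive inverse of \<open>k\<close> modulo
      \<open>n\<close>; adding it cancels the shift without subtraction on naturals.\<close>
    have shift: "(l + k + (n - 1) * k) mod n = l mod n" for l
    proof -
      have "k + (n - 1) * k = n * k" using n by (cases n) auto
      then have "l + k + (n - 1) * k = l + k * n" by (simp add: add.assoc mult.commute)
      then show ?thesis by (simp only: mod_mult_self1)
    qed
    show "i mod n = j mod n"
      using arg_cong[OF eq, of "\<lambda>m. (m + (n - 1) * k) mod n"] by (simp only: mod_add_left_eq shift)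
  qed (metis mod_add_left_eq)
  have inj: "inj_on (\<lambda>i. (i + k) mod n) {..<n}" by (auto simp: inj_on_def eq)
  moreover have "(\<lambda>i. (i + k) mod n) ` {..<n} \<subseteq> {..<n}" using n by auto
  ultimately have im: "(\<lambda>i. (i + k) mod n) ` {..<n} = {..<n}"
    by (simp add: endo_inj_surj)
  show ?thesis unfolding cycle_on_def
  proof (intro conjI allI impI)
    show "inj_on (\<lambda>i. p ((i + k) mod n)) {..<n}"
      using comp_inj_on[OF inj, of p] p by (simp add: im cycle_on_def comp_def)
    show "N = (\<lambda>i. p ((i + k) mod n)) ` {..<n}"
      using p im by (metis (no_types, lifting) cycle_on_def image_image image_cong)
    fix i j assume ij: "i < n" "j < n"
    have "(j + k) mod n = Suc ((i + k) mod n) mod n \<longleftrightarrow> j = Suc i mod n" if "i < n" "j < n" for i j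
      using eq[of j "Suc i"] that by (simp add: mod_Suc_eq)
    then show "(p ((i + k) mod n), p ((j + k) mod n)) \<in> E \<longleftrightarrow> j = Suc i mod n \<or> i = Suc j mod n"
      using p ij n by (auto simp: cycle_on_def)
  qed
qed

text \<open>After a rotation \<open>x\<close> carries the last index \<open>m\<close>, so the
  successor modulo \<open>Suc m\<close> is the plain successor on the remaining indices.\<close>

lemma cycle_on_remove:
  assumes p: "cycle_on n p N E" "3 \<le> n" and x: "x \<in> N"
  obtains xs where "path_list xs (N - {x}) E" "xs \<noteq> []"
proof -
  obtain i where i: "i < n" "x = p i" using p x by (auto simp: cycle_on_def)
  obtain m where m: "n = Suc m" "2 \<le> m" using p(2) by (cases n) auto
  define q where "q = (\<lambda>j. p ((j + Suc i) mod n))"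
  have "cycle_on n q N E" unfolding q_def using p by (intro cycle_on_rotate) auto
  then have q: "inj_on q {..<Suc m}" "N = q ` {..<Suc m}"
    "\<And>i j. i < Suc m \<Longrightarrow> j < Suc m \<Longrightarrow> (q i, q j) \<in> E \<longleftrightarrow> j = Suc i mod Suc m \<or> i = Suc j mod Suc m"
    by (auto simp: cycle_on_def m(1))
  have "m + Suc i = i + n" using m(1) by simp
  then have qm: "q m = x" using i unfolding q_def by (simp only: mod_add_self2 mod_less)
  have "N - {x} = q ` ({..<Suc m} - {m})"
    using inj_on_image_set_diff[OF q(1), of "{..<Suc m}" "{m}"] by (simp add: q(2) qm)
  also have "{..<Suc m} - {m} = {..<m}" by auto
  finally have N: "N - {x} = q ` {..<m}" .
  show thesis
  proof (rule that[of "map q [0..<m]"])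
    show "path_list (map q [0..<m]) (N - {x}) E"
      unfolding path_list_def
    proof (intro conjI allI impI)
      have "inj_on q {0..<m}" by (rule inj_on_subset[OF q(1)]) auto
      then show "distinct (map q [0..<m])" by (simp add: distinct_map)
      show "set (map q [0..<m]) = N - {x}" by (simp add: N atLeast0LessThan)
      fix i j assume "i < length (map q [0..<m])" "j < length (map q [0..<m])"
      then have "i < m" "j < m" by simp_all
      then show "(map q [0..<m] ! i, map q [0..<m] ! j) \<in> E \<longleftrightarrow> j = Suc i \<or> i = Suc j"
        using q(3)[of i j] by simp
    qed
    show "map q [0..<m] \<noteq> []" using m by simp
  qed
qed

text \<open>A face on an edge is determined by its third corner, a common neighbour of the two ends.
  This turns hypotheses on common neighbours into face counts.\<close>

lemma triangles_through_edge:
  assumes "sym E" "irrefl E" "(x, y) \<in> E"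
  shows "{t \<in> triangles E. x \<in> t \<and> y \<in> t} = (\<lambda>z. {x, y, z}) ` (E `` {x} \<inter> E `` {y})"
    and "card {t \<in> triangles E. x \<in> t \<and> y \<in> t} = card (E `` {x} \<inter> E `` {y})"
proof -
  have xy: "x \<noteq> y" using assms by (auto simp: irrefl_def)
  show *: "{t \<in> triangles E. x \<in> t \<and> y \<in> t} = (\<lambda>z. {x, y, z}) ` (E `` {x} \<inter> E `` {y})"
    using assms xy by (auto intro: triangleI elim!: triangleE[of _ E x y])
  have "inj_on (\<lambda>z. {x, y, z}) (E `` {x} \<inter> E `` {y})"
  proof (rule inj_onI)
    fix z w assume "z \<in> E `` {x} \<inter> E `` {y}" "w \<in> E `` {x} \<inter> E `` {y}" "{x, y, z} = {x, y, w}"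
    moreover have "z \<noteq> x" "z \<noteq> y" "w \<noteq> x" "w \<noteq> y"
      using calculation assms(2) by (auto simp: irrefl_def)
    ultimately show "z = w" by auto
  qed
  then show "card {t \<in> triangles E. x \<in> t \<and> y \<in> t} = card (E `` {x} \<inter> E `` {y})"
    by (simp add: * card_image)
qed

section \<open>From spheres to disks\<close>

text \<open>Every edge lies on two faces, so the sum of all faces is a 2-cycle: the mod 2
  fundamental class of a closed surface.\<close>

lemma face_boundary_all_triangles:
  assumes "sym E" "irrefl E" "\<And>x y. (x, y) \<in> E \<Longrightarrow> card (E `` {x} \<inter> E `` {y}) = 2"
  shows "face_boundary (triangles E) = {}"
proof -
  have "even (card {t \<in> triangles E. x \<in> t \<and> y \<in> t})" if "x \<noteq> y" for x y
  proof (cases "(x, y) \<in> E")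
    case True
    then have "card {t \<in> triangles E. x \<in> t \<and> y \<in> t} = 2"
      using assms(3) triangles_through_edge(2)[OF assms(1,2)] by simp
    then show ?thesis by simp
  next
    case False
    then have "{t \<in> triangles E. x \<in> t \<and> y \<in> t} = {}" using that by (auto simp: triangles_def)
    then show ?thesis by (metis (no_types, lifting) card.empty even_zero)
  qed
  then show ?thesis by (auto simp: face_boundary_def)
qed

text \<open>In a closed surface, a 2-chain bounding a cycle that avoids \<open>y\<close> contains all faces at \<open>y\<close>
  or none of them, since the link of \<open>y\<close> is connected; in the first case its complement bounds the
  same cycle.\<close>

lemma acyclic1_del_vertex:
  assumes E: "finite E" "sym E" "irrefl E"
    and codegree: "\<And>x y. (x, y) \<in> E \<Longrightarrow> card (E `` {x} \<inter> E `` {y}) = 2"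
    and acyclic: "acyclic1 E"
    and p: "cycle_on n p (E `` {y}) E" "3 \<le> n"
  shows "acyclic1 (E \<inter> (- {y}) \<times> (- {y}))"
  unfolding acyclic1_def
proof (intro allI impI)
  let ?E = "E \<inter> (- {y}) \<times> (- {y})"
  fix D assume D: "D \<subseteq> ?E" "sym D" "even_degrees D"
  have avoid: "S \<subseteq> triangles ?E" if "S \<subseteq> triangles E" "\<And>t. t \<in> S \<Longrightarrow> y \<notin> t" for S
    using that by (fastforce simp: triangles_def)
  obtain S where S: "S \<subseteq> triangles E" "face_boundary S = D"
    using acyclic1E[OF acyclic, of D] D by auto
  have fin: "finite (triangles E)" using E(1) by (rule finite_triangles)
  \<comment> \<open>The faces around \<open>y\<close> in cyclic order; \<open>t i\<close> and
    \<open>t (Suc i)\<close> share the edge from \<open>y\<close> to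
    \<open>p (Suc i)\<close>.\<close>
  define t where "t i = {y, p i, p (Suc i mod n)}" for i
  have pE: "(y, p i) \<in> E" if "i < n" for i using p that by (auto simp: cycle_on_def)
  have pp: "(p i, p j) \<in> E \<longleftrightarrow> j = Suc i mod n \<or> i = Suc j mod n" if "i < n" "j < n" for i j
    using p that by (simp add: cycle_on_def)
  have t: "t i \<in> triangles E" if "i < n" for i
    unfolding t_def using E that p(2) by (intro triangleI) (auto simp: pE pp)
  have step: "t (Suc i) \<in> S \<longleftrightarrow> t i \<in> S" if i: "Suc i < n" for i
  proof -
    let ?T = "{t \<in> triangles E. y \<in> t \<and> p (Suc i) \<in> t}"
    have neq: "t i \<noteq> t (Suc i)"
    proof
      assume "t i = t (Suc i)"
      moreover have "p i \<noteq> y" using pE[of i] E i by (auto simp: irrefl_def)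
      ultimately have "p i = p (Suc i) \<or> p i = p (Suc (Suc i) mod n)"
        using i by (auto simp: t_def)
      then have "i = Suc i \<or> i = Suc (Suc i) mod n"
        using p i inj_onD[of p "{..<n}" i "Suc i"] inj_onD[of p "{..<n}" i "Suc (Suc i) mod n"]
        by (auto simp: cycle_on_def)
      then show False using p(2) i by (auto simp: mod_Suc split: if_splits)
    qed
    have sub: "{t i, t (Suc i)} \<subseteq> ?T" using t[of i] t[of "Suc i"] i by (auto simp: t_def)
    have "card ?T = 2"
      using triangles_through_edge(2)[OF E(2,3) pE[OF i]] codegree[OF pE[OF i]] by simp
    then have T: "?T = {t i, t (Suc i)}"
      using sub neq fin card_subset_eq[of ?T "{t i, t (Suc i)}"] by simp
    \<comment> \<open>\<open>S\<close> bounds \<open>D\<close>, which has no edge at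
      \<open>y\<close>; so \<open>S\<close> contains both or neither of the two faces on this
      edge.\<close>
    have "even (card {t \<in> S. y \<in> t \<and> p (Suc i) \<in> t})"
    proof -
      have "(y, p (Suc i)) \<notin> face_boundary S" using D S by auto
      moreover have "y \<noteq> p (Suc i)" using pE[OF i] E by (auto simp: irrefl_def)
      ultimately show ?thesis by (simp add: face_boundary_def)
    qed
    moreover have "{t \<in> S. y \<in> t \<and> p (Suc i) \<in> t} = S \<inter> ?T" using S by auto
    ultimately have "even (card (S \<inter> {t i, t (Suc i)}))" using T by simp
    then show ?thesis using neq by (cases "t i \<in> S"; cases "t (Suc i) \<in> S") auto
  qed
  have const: "t i \<in> S \<longleftrightarrow> t 0 \<in> S" if "i < n" for i
    using that by (induction i) (auto simp: step)
  have at_y: "\<exists>i<n. s = t i" if s: "s \<in> triangles E" "y \<in> s" for s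
  proof -
    have "card s = 3" using s by (simp add: triangles_def)
    then have "\<not> s \<subseteq> {y}" using card_mono[of "{y}" s] by auto
    then obtain u where "u \<in> s" "u \<noteq> y" by auto
    then obtain w where w: "s = {y, u, w}" "(y, u) \<in> E" "(y, w) \<in> E" "(u, w) \<in> E"
      using s by (metis triangleE)
    moreover have "E `` {y} = p ` {..<n}" using p by (simp add: cycle_on_def)
    ultimately obtain i j where "i < n" "j < n" "u = p i" "w = p j" by blast
    then show ?thesis using w pp[of i j] by (auto simp: t_def insert_commute)
  qed
  show "\<exists>S\<subseteq>triangles ?E. face_boundary S = D"
  proof (cases "t 0 \<in> S")
    case False
    have "y \<notin> s" if s: "s \<in> S" for s
    proof
      assume "y \<in> s"
      then obtain i where "i < n" "s = t i" using at_y s S by blast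
      then show False using const s False by auto
    qed
    then show ?thesis using S avoid by blast
  next
    case True
    have "y \<notin> s" if s: "s \<in> triangles E - S" for s
    proof
      assume "y \<in> s"
      then obtain i where "i < n" "s = t i" using at_y s by blast
      then show False using const s True by auto
    qed
    then have "triangles E - S \<subseteq> triangles ?E" by (intro avoid) auto
    moreover have "face_boundary (triangles E - S) = D"
    proof -
      have "sym_diff (triangles E) S = triangles E - S" using S by auto
      moreover have "finite S" using S fin by (auto intro: finite_subset)
      ultimately show ?thesis
        using face_boundary_sym_diff[OF fin, of S] face_boundary_all_triangles[OF E(2,3) codegree] S(2)
        by simp
    qed
    ultimately show ?thesis by blast
  qed
qed

text \<open>The cyclic links of interior vertices enter only through \<open>K4_free\<close> and \<open>codegree\<close>: links are
  triangle-free and 2-regular, except at boundary vertices.\<close>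

locale disk =
  fixes V :: "'a set" and E :: "'a rel" and B :: "'a set"
  assumes finite_V: "finite V"
    and E_subset: "E \<subseteq> V \<times> V"
    and sym: "sym E"
    and irrefl: "irrefl E"
    and B_subset: "B \<subseteq> V"
    and K4_free: "(x, y) \<in> E \<Longrightarrow> (x, z) \<in> E \<Longrightarrow> (y, z) \<in> E \<Longrightarrow> (x, w) \<in> E \<Longrightarrow> (y, w) \<in> E \<Longrightarrow> (z, w) \<notin> E"
    and codegree: "(x, y) \<in> E \<Longrightarrow> card (E `` {x} \<inter> E `` {y}) = (if x \<in> B \<and> y \<in> B then 1 else 2)"
    and boundary_link: "v \<in> B \<Longrightarrow> \<exists>xs. xs \<noteq> [] \<and> path_list xs (E `` {v}) E"
    and acyclic: "acyclic1 E"
begin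

lemma finite_E: "finite E"
  using E_subset finite_V finite_subset by blast

end

text \<open>The boundary set is the link of the deleted vertex \<open>y\<close>: an edge loses the
  common neighbour \<open>y\<close> exactly when both its ends lie there. Contractibility is given
  for a possibly different complement \<open>H - x\<close>, so acyclicity is lifted to
  \<open>H\<close> by coning over the link of \<open>x\<close> and then restricted to
  \<open>H - y\<close>.\<close>

lemma two_ball_disk:
  assumes "two_ball (with_proj G)"
  shows "\<exists>B. disk (pverts G) (parcs G) B"
proof -
  obtain H y where H: "two_sphere H" "y \<in> verts H" "with_proj G = pre_digraph.del_vert H y"
    using assms by (auto simp: two_ball_def)
  define F where "F = arcs_ends H"
  have "graph H" using H by (simp add: two_sphere_def)
  note gH = graph_arcs_ends[OF this, folded F_def]
  have V: "pverts G = verts H - {y}"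
    using arg_cong[OF H(3), of verts] by (simp add: pre_digraph.verts_del_vert)
  have E: "parcs G = F \<inter> (- {y}) \<times> (- {y})"
    using arg_cong[OF H(3), of arcs_ends] by (simp add: arcs_ends_del_vert F_def)
  have cyc: "\<exists>n p. 4 \<le> n \<and> cycle_on n p (F `` {x}) F" if x: "x \<in> verts H" for x
  proof -
    obtain n where n: "4 \<le> n" "is_cyclic_graph n (unit_sphere H x)"
      using H(1) x unfolding two_sphere_def by blast
    obtain p where "cycle_on n p (verts (unit_sphere H x)) (arcs_ends (unit_sphere H x))"
      using is_cyclic_graphD[OF n(2)] by metis
    then have "cycle_on n p (F `` {x}) F"
      by (simp add: verts_unit_sphere arcs_ends_unit_sphere cycle_on_restrict F_def)
    with n(1) show ?thesis by blast
  qed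
  have codegree: "card (F `` {x} \<inter> F `` {z}) = 2" if xz: "(x, z) \<in> F" for x z
  proof -
    obtain n p where "4 \<le> n" "cycle_on n p (F `` {x}) F" using cyc xz gH by blast
    then have "card (F `` {z} \<inter> F `` {x}) = 2" using xz by (intro cycle_on_card_neighbours) auto
    then show ?thesis by (simp add: Int_commute)
  qed
  have acyclicF: "acyclic1 F"
  proof -
    obtain x where x: "x \<in> verts H" "contractible (pre_digraph.del_vert H x)"
      using H by (auto simp: two_sphere_def)
    obtain n p where "4 \<le> n" "cycle_on n p (F `` {x}) F" using cyc x by blast
    then have "acyclic0 (F `` {x}) F" using gH by (intro acyclic0_cycle_on) auto
    moreover have "acyclic1 (F \<inter> (- {x}) \<times> (- {x}))"
      using contractible_acyclic[OF x(2)] by (simp add: arcs_ends_del_vert F_def)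
    ultimately show ?thesis by (rule acyclic1_if_acyclic1_del[OF gH(1-3)])
  qed
  have "disk (pverts G) (parcs G) (F `` {y})"
    unfolding V E
  proof
    show "finite (verts H - {y})" using gH by simp
    show "F \<inter> (- {y}) \<times> (- {y}) \<subseteq> (verts H - {y}) \<times> (verts H - {y})" using gH by auto
    show "sym (F \<inter> (- {y}) \<times> (- {y}))" using gH by (auto simp: sym_def)
    show "irrefl (F \<inter> (- {y}) \<times> (- {y}))" using gH by (auto simp: irrefl_def)
    show "F `` {y} \<subseteq> verts H - {y}" using gH by (auto simp: irrefl_def)
    show "acyclic1 (F \<inter> (- {y}) \<times> (- {y}))"
    proof -
      obtain n p where "4 \<le> n" "cycle_on n p (F `` {y}) F" using cyc H by blast
      then show ?thesis using acyclic1_del_vertex[OF gH(1-3) codegree acyclicF] by simp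
    qed
  next
    fix x1 x2 x3 x4
    assume "(x1, x2) \<in> F \<inter> (- {y}) \<times> (- {y})" "(x1, x3) \<in> F \<inter> (- {y}) \<times> (- {y})"
      "(x2, x3) \<in> F \<inter> (- {y}) \<times> (- {y})" "(x1, x4) \<in> F \<inter> (- {y}) \<times> (- {y})"
      "(x2, x4) \<in> F \<inter> (- {y}) \<times> (- {y})"
    then have x: "(x1, x2) \<in> F" "(x1, x3) \<in> F" "(x2, x3) \<in> F" "(x1, x4) \<in> F" "(x2, x4) \<in> F" by auto
    moreover obtain n p where "4 \<le> n" "cycle_on n p (F `` {x1}) F" using cyc x gH by blast
    \<comment> \<open>A K_4 would leave a triangle in the link of \<open>x1\<close>, which is a
      cycle of length at least 4.\<close>
    ultimately have "(x3, x4) \<notin> F" using cycle_on_triangle_free[of n p "F `` {x1}" F x2 x3 x4] by auto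
    then show "(x3, x4) \<notin> F \<inter> (- {y}) \<times> (- {y})" by auto
  next
    fix x z assume "(x, z) \<in> F \<inter> (- {y}) \<times> (- {y})"
    then have xz: "(x, z) \<in> F" "x \<noteq> y" "z \<noteq> y" by auto
    have "(F \<inter> (- {y}) \<times> (- {y})) `` {x} \<inter> (F \<inter> (- {y}) \<times> (- {y})) `` {z}
        = F `` {x} \<inter> F `` {z} - {y}"
      using xz by auto
    moreover have "y \<in> F `` {x} \<inter> F `` {z} \<longleftrightarrow> x \<in> F `` {y} \<and> z \<in> F `` {y}"
      using gH(2) by (auto dest: symD)
    ultimately show "card ((F \<inter> (- {y}) \<times> (- {y})) `` {x} \<inter> (F \<inter> (- {y}) \<times> (- {y})) `` {z}) =
        (if x \<in> F `` {y} \<and> z \<in> F `` {y} then 1 else 2)"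
      using codegree[OF xz(1)] by (auto simp: card_Diff_singleton_if)
  next
    fix v assume v: "v \<in> F `` {y}"
    then obtain n p where "4 \<le> n" "cycle_on n p (F `` {v}) F" using cyc gH by blast
    moreover have "y \<in> F `` {v}" using v gH(2) by (auto dest: symD)
    ultimately obtain xs where xs: "path_list xs (F `` {v} - {y}) F" "xs \<noteq> []"
      using cycle_on_remove[of n p "F `` {v}" F y] by auto
    moreover have "F `` {v} - {y} = (F \<inter> (- {y}) \<times> (- {y})) `` {v}"
      using v gH by (auto simp: irrefl_def)
    moreover have "path_list xs N (F \<inter> (- {y}) \<times> (- {y}))" if "path_list xs N F" "y \<notin> N" for N
      using that nth_mem[of _ xs] by (force simp: path_list_def)
    ultimately show "\<exists>xs. xs \<noteq> [] \<and>
        path_list xs ((F \<inter> (- {y}) \<times> (- {y})) `` {v}) (F \<inter> (- {y}) \<times> (- {y}))"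
      by (metis Diff_iff singletonI)
  qed
  then show ?thesis by blast
qed

text \<open>Ties the set \<open>B\<close> of the locale to the unit spheres. If the sphere of
  \<open>v\<close> is a path, its first vertex has at most one neighbour inside it, and an edge with
  fewer than two common neighbours has both ends in \<open>B\<close>.\<close>

lemma boundary_verts_disk:
  assumes "disk (pverts G) (parcs G) B"
  shows "boundary_verts (with_proj G) = B"
proof -
  let ?V = "pverts G" and ?E = "parcs G"
  interpret disk ?V ?E B by fact
  show ?thesis
  proof (intro equalityI subsetI)
    fix v assume v: "v \<in> B"
    let ?N = "?E `` {v}"
    obtain xs where xs: "xs \<noteq> []" "path_list xs ?N ?E" using boundary_link[OF v] by blast
    define Q where "Q = \<lparr>pverts = ?N, parcs = ?E \<inter> ?N \<times> ?N\<rparr>"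
    have Q: "unit_sphere (with_proj G) v = with_proj Q"
      by (auto simp: unit_sphere_def induce_subgraph_def with_proj_def Q_def arcs_ends_conv)
    have "digraph_iso (with_proj (path_graph (length xs))) (with_proj Q)"
    proof (rule digraph_isoI[of "(!) xs"])
      have "distinct xs" using xs by (simp add: path_list_def)
      then show "inj_on ((!) xs) (pverts (path_graph (length xs)))"
        by (simp add: path_graph_def inj_on_nth)
      show "pverts Q = (!) xs ` pverts (path_graph (length xs))"
        using xs by (auto simp: path_list_def Q_def path_graph_def set_conv_nth)
      fix i j assume "i \<in> pverts (path_graph (length xs))" "j \<in> pverts (path_graph (length xs))"
      then show "(xs ! i, xs ! j) \<in> parcs Q \<longleftrightarrow> (i, j) \<in> parcs (path_graph (length xs))"
        using xs by (auto simp: path_list_def Q_def path_graph_def)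
    qed (auto simp: path_graph_def Q_def)
    then have "is_path_graph (length xs) (unit_sphere (with_proj G) v)"
      using xs(1) by (simp add: Q is_path_graph_def Suc_le_eq)
    then show "v \<in> boundary_verts (with_proj G)"
      using v B_subset by (auto simp: boundary_verts_def)
  next
    fix v assume "v \<in> boundary_verts (with_proj G)"
    then obtain n where n: "1 \<le> n"
      and iso: "digraph_iso (with_proj (path_graph n)) (unit_sphere (with_proj G) v)"
      by (auto simp: boundary_verts_def is_path_graph_def)
    let ?N = "?E `` {v}"
    from iso obtain p where p: "inj_on p {..<n}" "?N = p ` {..<n}"
      "\<And>i j. i < n \<Longrightarrow> j < n \<Longrightarrow> (p i, p j) \<in> ?E \<inter> ?N \<times> ?N \<longleftrightarrow> j = Suc i \<or> i = Suc j"
      by (rule digraph_isoD) (auto simp: path_graph_def verts_unit_sphere arcs_ends_unit_sphere)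
    have "p 0 \<in> ?N" using n p(2) by auto
    then have "(v, p 0) \<in> ?E" by simp
    have "?N \<inter> ?E `` {p 0} \<subseteq> {p 1}"
    proof
      fix w assume w: "w \<in> ?N \<inter> ?E `` {p 0}"
      then obtain j where "j < n" "w = p j" using p(2) by blast
      moreover have "(p 0, w) \<in> ?E \<inter> ?N \<times> ?N" using w \<open>p 0 \<in> ?N\<close> by auto
      ultimately show "w \<in> {p 1}" using p(3)[of 0 j] n by auto
    qed
    then have "card (?N \<inter> ?E `` {p 0}) \<le> 1"
      using card_mono[of "{p 1}"] by fastforce
    then show "v \<in> B" using codegree[OF \<open>(v, p 0) \<in> ?E\<close>] by (auto split: if_splits)
  qed
qed

section \<open>Refinement of disks\<close>

lemma path_list_map:
  assumes "path_list xs N E" "inj_on f N"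
    and "\<And>x y. x \<in> N \<Longrightarrow> y \<in> N \<Longrightarrow> (f x, f y) \<in> E' \<longleftrightarrow> (x, y) \<in> E"
  shows "path_list (map f xs) (f ` N) E'"
  using assms by (auto simp: path_list_def distinct_map)

text \<open>What a refinement does to the link of a common neighbour of \<open>a\<close> and
  \<open>b\<close>: the edge \<open>ab\<close> of that link is subdivided by
  \<open>c\<close>.\<close>

lemma path_list_insert:
  assumes xs: "path_list xs N E" and i: "Suc i < length xs" and c: "c \<notin> N"
    and E': "\<And>x y. x \<in> N \<Longrightarrow> y \<in> N \<Longrightarrow> (x, y) \<in> E' \<longleftrightarrow>
      (x, y) \<in> E \<and> (x, y) \<noteq> (xs ! i, xs ! Suc i) \<and> (x, y) \<noteq> (xs ! Suc i, xs ! i)"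
      "\<And>x. x \<in> N \<Longrightarrow> (x, c) \<in> E' \<longleftrightarrow> x = xs ! i \<or> x = xs ! Suc i"
      "\<And>x. x \<in> N \<Longrightarrow> (c, x) \<in> E' \<longleftrightarrow> x = xs ! i \<or> x = xs ! Suc i"
      "(c, c) \<notin> E'"
  shows "path_list (take (Suc i) xs @ c # drop (Suc i) xs) (insert c N) E'"
proof -
  let ?ys = "take (Suc i) xs @ c # drop (Suc i) xs"
  have dist: "distinct xs" and N: "set xs = N"
    and adj: "\<And>k l. k < length xs \<Longrightarrow> l < length xs \<Longrightarrow> (xs ! k, xs ! l) \<in> E \<longleftrightarrow> l = Suc k \<or> k = Suc l"
    using xs by (auto simp: path_list_def)
  have eq: "xs ! k = xs ! l \<longleftrightarrow> k = l" if "k < length xs" "l < length xs" for k l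
    using dist that by (rule nth_eq_iff_index_eq)
  have mem: "xs ! k \<in> N" if "k < length xs" for k using N that by auto
  \<comment> \<open>Away from \<open>Suc i\<close>, the place of \<open>c\<close>, \<open>g\<close>
    sends a position in the new list to the position of the same vertex in the old one.\<close>
  define g where "g k = (if k \<le> i then k else k - 1)" for k
  have nth: "?ys ! k = (if k = Suc i then c else xs ! g k)" if "k < Suc (length xs)" for k
  proof -
    consider "k \<le> i" | "k = Suc i" | d where "k = Suc (Suc i + d)"
      using less_imp_Suc_add[of "Suc i" k] by (cases "k \<le> i"; cases "k = Suc i") auto
    then show ?thesis using i that by cases (auto simp: nth_append g_def)
  qed
  have g: "g k < length xs" if "k < Suc (length xs)" for k using i that by (auto simp: g_def)
  have adj': "(xs ! k, xs ! l) \<in> E' \<longleftrightarrow> (l = Suc k \<and> k \<noteq> i) \<or> (k = Suc l \<and> l \<noteq> i)"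
    if "k < length xs" "l < length xs" for k l
    using that i by (auto simp: E'(1)[OF mem mem] adj eq)
  have set: "set ?ys = insert c N"
    using N by (metis Un_insert_right append_take_drop_id list.simps(15) set_append)
  have "distinct ?ys"
  proof -
    have "distinct (take (Suc i) xs @ drop (Suc i) xs)" using dist by simp
    moreover have "c \<notin> set (take (Suc i) xs)" "c \<notin> set (drop (Suc i) xs)"
      using c N by (auto dest: in_set_takeD in_set_dropD)
    ultimately show ?thesis unfolding distinct_append by auto
  qed
  moreover have "(?ys ! k, ?ys ! l) \<in> E' \<longleftrightarrow> l = Suc k \<or> k = Suc l"
    if "k < Suc (length xs)" "l < Suc (length xs)" for k l
  proof (cases "k = Suc i"; cases "l = Suc i")
    assume "k \<noteq> Suc i" "l \<noteq> Suc i"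
    then show ?thesis using that by (simp add: nth adj' g) (auto simp: g_def)
  next
    assume k: "k = Suc i" and l: "l \<noteq> Suc i"
    then show ?thesis using that i by (simp add: nth E'(3)[OF mem] eq g) (auto simp: g_def)
  next
    assume k: "k \<noteq> Suc i" and l: "l = Suc i"
    then show ?thesis using that i by (simp add: nth E'(2)[OF mem] eq g) (auto simp: g_def)
  next
    assume k: "k = Suc i" and l: "l = Suc i"
    then show ?thesis using that E'(4) by (simp add: nth)
  qed
  moreover have "length ?ys = Suc (length xs)" using i by simp
  ultimately show ?thesis using set by (simp only: path_list_def) blast
qed

text \<open>Each of the six edges lies on exactly two of the four faces. Adding a tetrahedron to a
  2-chain therefore leaves its boundary unchanged.\<close>

lemma face_boundary_tetrahedron:
  assumes "distinct [a, b, c, d]"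
  shows "face_boundary {{a, b, c}, {a, b, d}, {a, c, d}, {b, c, d}} = {}"
proof -
  have neq: "{a, b, c} \<notin> {{a, b, d}, {a, c, d}, {b, c, d}}" "{a, b, d} \<notin> {{a, c, d}, {b, c, d}}"
    "{a, c, d} \<notin> {{b, c, d}}"
    using assms by auto
  let ?K = "\<lambda>t. {(x, y). x \<in> t \<and> y \<in> t \<and> x \<noteq> y}"
  have "face_boundary {{a, b, c}, {a, b, d}, {a, c, d}, {b, c, d}} =
      sym_diff (sym_diff (sym_diff (?K {b, c, d}) (?K {a, c, d})) (?K {a, b, d})) (?K {a, b, c})"
    using neq by (simp only: face_boundary_insert face_boundary_singleton finite.intros not_False_eq_True)
  also have "\<dots> = {}" using assms by auto
  finally show ?thesis .
qed

definition refine :: "'a rel \<Rightarrow> 'a \<Rightarrow> 'a \<Rightarrow> 'a \<Rightarrow> 'a rel" where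
  "refine E a b c = (let W = E `` {a} \<inter> E `` {b} in
     (E - {(a, b), (b, a)}) \<union> {(a, c), (c, a), (c, b), (b, c)} \<union> {c} \<times> W \<union> W \<times> {c})"

lemma edge_refinement_eq:
  "edge_refinement G a b c = \<lparr>pverts = insert c (pverts G), parcs = refine (parcs G) a b c\<rparr>"
  by (simp add: edge_refinement_def refine_def verts_unit_sphere Let_def)

lemma refine_commute: "refine E b a c = refine E a b c"
  by (auto simp: refine_def Let_def)

lemma card_swap: "finite A \<Longrightarrow> x \<in> A \<Longrightarrow> y \<notin> A \<Longrightarrow> card (insert y (A - {x})) = card A"
  by (metis Diff_iff card_Suc_Diff1 card_insert_disjoint finite_Diff)

text \<open>\<open>u\<close> and \<open>v\<close> are the apexes of the two faces on the interior
  edge \<open>ab\<close>. The setting is symmetric under exchanging \<open>a\<close> with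
  \<open>b\<close> and \<open>u\<close> with \<open>v\<close> (\<open>swap_ab\<close>,
  \<open>swap_uv\<close>), which shortens the case analysis around the new vertex
  \<open>c\<close>.\<close>

locale disk_edge = disk +
  fixes a b c u v :: 'a
  assumes ab: "(a, b) \<in> E"
    and interior: "\<not> (a \<in> B \<and> b \<in> B)"
    and c: "c \<notin> V"
    and common: "E `` {a} \<inter> E `` {b} = {u, v}"
    and uv: "u \<noteq> v"
begin

abbreviation E' where "E' \<equiv> refine E a b c"

lemma edges: "(b, a) \<in> E" "(a, u) \<in> E" "(u, a) \<in> E" "(a, v) \<in> E" "(v, a) \<in> E"
  "(b, u) \<in> E" "(u, b) \<in> E" "(b, v) \<in> E" "(v, b) \<in> E"
proof -
  have "u \<in> E `` {a} \<inter> E `` {b}" "v \<in> E `` {a} \<inter> E `` {b}" unfolding common by auto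
  then show "(b, a) \<in> E" "(a, u) \<in> E" "(u, a) \<in> E" "(a, v) \<in> E" "(v, a) \<in> E"
    "(b, u) \<in> E" "(u, b) \<in> E" "(b, v) \<in> E" "(v, b) \<in> E"
    using ab sym by (auto dest: symD)
qed

text \<open>Otherwise \<open>a\<close>, \<open>b\<close>, \<open>u\<close>, \<open>v\<close> would
  form a K_4. Consequently the link of \<open>c\<close> after the refinement is the 4-cycle
  \<open>a\<close>, \<open>u\<close>, \<open>b\<close>, \<open>v\<close>.\<close>

lemma not_uv: "(u, v) \<notin> E" "(v, u) \<notin> E"
  using K4_free[of a b u v] K4_free[of a b v u] edges ab by auto

lemma fresh: "(c, x) \<notin> E" "(x, c) \<notin> E"
  using c E_subset by auto

lemma distinct: "a \<noteq> b" "b \<noteq> a" "a \<noteq> u" "u \<noteq> a" "a \<noteq> v" "v \<noteq> a" "b \<noteq> u" "u \<noteq> b" "b \<noteq> v" "v \<noteq> b" "v \<noteq> u"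
  "c \<noteq> a" "a \<noteq> c" "c \<noteq> b" "b \<noteq> c" "c \<noteq> u" "u \<noteq> c" "c \<noteq> v" "v \<noteq> c"
  using edges ab irrefl fresh uv by (auto simp: irrefl_def)

lemma c_not_B: "c \<notin> B"
  using c B_subset by auto

lemma E'_eq: "E' = (E - {(a, b), (b, a)}) \<union>
    {(a, c), (c, a), (b, c), (c, b), (u, c), (c, u), (v, c), (c, v)}"
  unfolding refine_def Let_def common by auto

lemma symE: "(x, y) \<in> E \<Longrightarrow> (y, x) \<in> E"
  using sym by (rule symD)

lemma irreflE: "(x, x) \<notin> E"
  using irrefl by (simp add: irrefl_def)

lemma sym_E': "sym E'"
proof (rule symI)
  fix x y
  assume "(x, y) \<in> E'"
  then show "(y, x) \<in> E'" using symE[of x y] unfolding E'_eq by blast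
qed

lemma irrefl_E': "irrefl E'"
  unfolding E'_eq irrefl_def using irreflE distinct by auto

lemma commonD: "(a, x) \<in> E \<Longrightarrow> (b, x) \<in> E \<Longrightarrow> x = u \<or> x = v"
  using common by blast

lemma nbrs':
  "E' `` {c} = {a, b, u, v}"
  "E' `` {a} = insert c (E `` {a} - {b})"
  "E' `` {b} = insert c (E `` {b} - {a})"
  "E' `` {u} = insert c (E `` {u})"
  "E' `` {v} = insert c (E `` {v})"
  "x \<notin> {a, b, c, u, v} \<Longrightarrow> E' `` {x} = E `` {x}"
proof -
  show "E' `` {c} = {a, b, u, v}" using fresh unfolding E'_eq by auto
  show "E' `` {a} = insert c (E `` {a} - {b})" using fresh distinct unfolding E'_eq by blast
  show "E' `` {b} = insert c (E `` {b} - {a})" using fresh distinct unfolding E'_eq by blast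
  show "E' `` {u} = insert c (E `` {u})" using fresh distinct unfolding E'_eq by blast
  show "E' `` {v} = insert c (E `` {v})" using fresh distinct unfolding E'_eq by blast
  assume "x \<notin> {a, b, c, u, v}"
  then show "E' `` {x} = E `` {x}" unfolding E'_eq by blast
qed

lemma codegree_c:
  assumes "(c, y) \<in> E'"
  shows "card (E' `` {c} \<inter> E' `` {y}) = 2"
proof -
  have y: "y \<in> {a, b, u, v}" using assms nbrs'(1) by auto
  have eqs: "{a, b, u, v} \<inter> E' `` {a} = {u, v}" "{a, b, u, v} \<inter> E' `` {b} = {u, v}"
    "{a, b, u, v} \<inter> E' `` {u} = {a, b}" "{a, b, u, v} \<inter> E' `` {v} = {a, b}"
    using nbrs' distinct edges not_uv irreflE by auto
  have two: "card {u, v} = 2" "card {a, b} = 2" using distinct uv by auto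
  from y show ?thesis
    unfolding nbrs'(1) by (elim insertE emptyE) (simp_all only: eqs two)
qed

text \<open>If \<open>y\<close> is \<open>u\<close> or \<open>v\<close>, then \<open>c\<close>
  replaces \<open>b\<close> as a common neighbour. Any other \<open>y\<close> is adjacent neither to
  \<open>b\<close> nor to \<open>c\<close>, so nothing changes.\<close>

lemma codegree_a:
  assumes "(a, y) \<in> E" "y \<noteq> b"
  shows "card (E' `` {a} \<inter> E' `` {y}) = card (E `` {a} \<inter> E `` {y})"
proof (cases "y = u \<or> y = v")
  case True
  then have "E' `` {y} = insert c (E `` {y})" using nbrs'(4,5) by metis
  then have "E' `` {a} \<inter> E' `` {y} = insert c ((E `` {a} \<inter> E `` {y}) - {b})"
    unfolding nbrs'(2) by auto
  moreover have "b \<in> E `` {a} \<inter> E `` {y}" using True ab edges by auto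
  moreover have "finite (E `` {a} \<inter> E `` {y})" using finite_E by (auto intro: finite_Image)
  moreover have "c \<notin> E `` {a} \<inter> E `` {y}" using fresh by auto
  ultimately show ?thesis by (metis card_swap)
next
  case False
  then have "y \<notin> {a, b, c, u, v}" using assms irreflE fresh by auto
  then have "E' `` {a} \<inter> E' `` {y} = E `` {a} \<inter> E `` {y}"
    using nbrs'(2) nbrs'(6)[of y] fresh commonD[of y] symE False assms by auto
  then show ?thesis by simp
qed

text \<open>Such a \<open>y\<close> is not \<open>v\<close>, as \<open>u\<close> and
  \<open>v\<close> are not adjacent; so it is not adjacent to \<open>c\<close> and keeps its
  neighbours.\<close>

lemma codegree_u:
  assumes "(u, y) \<in> E" "y \<noteq> a" "y \<noteq> b"
  shows "E' `` {u} \<inter> E' `` {y} = E `` {u} \<inter> E `` {y}"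
proof -
  have "y \<notin> {a, b, c, u, v}" using assms irreflE fresh not_uv by auto
  then show ?thesis using nbrs'(4) nbrs'(6)[of y] fresh by auto
qed

lemma swap_ab: "disk_edge V E B b a c u v"
  by unfold_locales (use edges ab interior c common uv in auto)

lemma swap_uv: "disk_edge V E B a b c v u"
  by unfold_locales (use edges ab interior c common uv in auto)

lemma codegree':
  assumes "(x, y) \<in> E'"
  shows "card (E' `` {x} \<inter> E' `` {y}) = (if x \<in> B \<and> y \<in> B then 1 else 2)"
proof -
  interpret ba: disk_edge V E B b a c u v by (rule swap_ab)
  interpret vu: disk_edge V E B a b c v u by (rule swap_uv)
  have ba: "refine E b a c = E'" by (rule refine_commute)
  consider "x = c" | "y = c" | "x \<noteq> c" "y \<noteq> c" "(x, y) \<in> E" "(x, y) \<noteq> (a, b)" "(x, y) \<noteq> (b, a)"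
    using assms E'_eq by auto
  then show ?thesis
  proof cases
    case 1
    then show ?thesis using codegree_c assms c_not_B by simp
  next
    case 2
    then have "(c, x) \<in> E'" using assms sym_E' by (auto dest: symD)
    then show ?thesis using codegree_c[of x] 2 c_not_B by (simp add: Int_commute)
  next
    case 3
    note yx = symE[OF \<open>(x, y) \<in> E\<close>]
    \<comment> \<open>Up to the two symmetries and the order of \<open>x\<close> and
      \<open>y\<close>, an old edge contains \<open>a\<close>, or contains \<open>u\<close>, or
      avoids all affected vertices.\<close>
    consider "x = a" | "x = b" | "y = a" | "y = b" | "x \<notin> {a, b}" "y \<notin> {a, b}" by auto
    then have "card (E' `` {x} \<inter> E' `` {y}) = card (E `` {x} \<inter> E `` {y})"
    proof cases
      case 1
      then show ?thesis using 3 codegree_a by auto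
    next
      case 2
      then show ?thesis using 3 ba.codegree_a ba by auto
    next
      case yxa: 3
      then show ?thesis using 3 yx codegree_a[of x] by (auto simp: Int_commute)
    next
      case 4
      then show ?thesis using 3 yx ba.codegree_a[of x] ba by (auto simp: Int_commute)
    next
      case 5
      consider "x = u" | "x = v" | "y = u" | "y = v" | "x \<notin> {a, b, c, u, v}" "y \<notin> {a, b, c, u, v}"
        using 3 5 by auto
      then have "E' `` {x} \<inter> E' `` {y} = E `` {x} \<inter> E `` {y}"
      proof cases
        case 1
        then show ?thesis using 3 5 codegree_u[of y] by auto
      next
        case 2
        then show ?thesis using 3 5 vu.codegree_u[of y] by auto
      next
        case yu: 3
        then show ?thesis using yx 5 codegree_u[of x] by (auto simp: Int_commute)
      next
        case 4
        then show ?thesis using yx 5 vu.codegree_u[of x] by (auto simp: Int_commute)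
      next
        case neither: 5
        then show ?thesis by (simp add: nbrs'(6))
      qed
      then show ?thesis by simp
    qed
    then show ?thesis using codegree 3 by simp
  qed
qed

text \<open>A K_4 through \<open>c\<close> would put a triangle into the 4-cycle around
  \<open>c\<close>; in a K_4 without \<open>c\<close> all edges are old.\<close>

lemma K4_free':
  assumes "(x, y) \<in> E'" "(x, z) \<in> E'" "(y, z) \<in> E'" "(x, w) \<in> E'" "(y, w) \<in> E'"
  shows "(z, w) \<notin> E'"
proof
  assume zw: "(z, w) \<in> E'"
  have no_triangle: False
    if "p \<in> {a, b, u, v}" "q \<in> {a, b, u, v}" "r \<in> {a, b, u, v}" "(p, q) \<in> E'" "(p, r) \<in> E'" "(q, r) \<in> E'"
    for p q r
    using that irreflE not_uv distinct unfolding E'_eq by auto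
  have c_nbr: "p \<in> {a, b, u, v}" if "(c, p) \<in> E' \<or> (p, c) \<in> E'" for p
    using that nbrs'(1) sym_E' by (auto dest: symD)
  have sub: "(p, q) \<in> E" if "(p, q) \<in> E'" "p \<noteq> c" "q \<noteq> c" for p q
    using that unfolding E'_eq by auto
  consider "x = c" | "y = c" | "z = c" | "w = c" | "x \<noteq> c" "y \<noteq> c" "z \<noteq> c" "w \<noteq> c" by blast
  then show False
  proof cases
    case 1
    then show False using no_triangle[of y z w] c_nbr assms zw by blast
  next
    case 2
    then show False using no_triangle[of x z w] c_nbr assms zw by blast
  next
    case 3
    then show False using no_triangle[of x y w] c_nbr assms zw by blast
  next
    case 4
    then show False using no_triangle[of x y z] c_nbr assms zw by blast
  next
    case 5
    then show False using K4_free[of x y z w] sub assms zw by blast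
  qed
qed

text \<open>In the link of \<open>a\<close> the vertex \<open>c\<close> takes the place of
  \<open>b\<close>, with the same neighbours \<open>u\<close> and \<open>v\<close>.\<close>

lemma boundary_link_a:
  assumes "a \<in> B"
  shows "\<exists>xs. xs \<noteq> [] \<and> path_list xs (E' `` {a}) E'"
proof -
  obtain xs where xs: "xs \<noteq> []" "path_list xs (E `` {a}) E" using boundary_link assms by blast
  let ?f = "\<lambda>y. if y = b then c else y"
  have "path_list (map ?f xs) (?f ` (E `` {a})) E'"
  proof (rule path_list_map[OF xs(2)])
    show "inj_on ?f (E `` {a})" using fresh by (auto simp: inj_on_def)
    fix x y assume xy: "x \<in> E `` {a}" "y \<in> E `` {a}"
    have b_iff: "(b, z) \<in> E \<longleftrightarrow> z = u \<or> z = v" "(z, b) \<in> E \<longleftrightarrow> z = u \<or> z = v" if "z \<in> E `` {a}" for z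
      using that commonD edges symE by auto
    show "(?f x, ?f y) \<in> E' \<longleftrightarrow> (x, y) \<in> E"
      using xy b_iff[of x] b_iff[of y] irreflE distinct fresh unfolding E'_eq by auto
  qed
  moreover have "?f ` (E `` {a}) = E' `` {a}" using ab unfolding nbrs' by auto
  ultimately show ?thesis using xs(1) by (intro exI[of _ "map ?f xs"]) simp
qed

lemma boundary_link_u:
  assumes "u \<in> B"
  shows "\<exists>xs. xs \<noteq> [] \<and> path_list xs (E' `` {u}) E'"
proof -
  obtain xs where xs: "path_list xs (E `` {u}) E" using boundary_link assms by blast
  have "a \<in> set xs" "b \<in> set xs" using xs edges by (auto simp: path_list_def)
  then obtain k l where kl: "k < length xs" "l < length xs" "xs ! k = a" "xs ! l = b"
    by (auto simp: in_set_conv_nth)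
  then have "l = Suc k \<or> k = Suc l" using xs ab by (auto simp: path_list_def)
  then obtain i where i: "Suc i < length xs" "xs ! i = a \<and> xs ! Suc i = b \<or> xs ! i = b \<and> xs ! Suc i = a"
    using kl by auto
  have "path_list (take (Suc i) xs @ c # drop (Suc i) xs) (insert c (E `` {u})) E'"
  proof (rule path_list_insert[OF xs i(1)])
    show "c \<notin> E `` {u}" "(c, c) \<notin> E'" using fresh distinct unfolding E'_eq by auto
    fix x assume x: "x \<in> E `` {u}"
    then have "x \<noteq> u" "x \<noteq> v" "x \<noteq> c" using irreflE not_uv fresh by auto
    then show "(x, c) \<in> E' \<longleftrightarrow> x = xs ! i \<or> x = xs ! Suc i" "(c, x) \<in> E' \<longleftrightarrow> x = xs ! i \<or> x = xs ! Suc i"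
      using i(2) fresh unfolding E'_eq by auto
    fix y assume "y \<in> E `` {u}"
    then have "y \<noteq> c" using fresh by auto
    with \<open>x \<noteq> c\<close> show "(x, y) \<in> E' \<longleftrightarrow>
        (x, y) \<in> E \<and> (x, y) \<noteq> (xs ! i, xs ! Suc i) \<and> (x, y) \<noteq> (xs ! Suc i, xs ! i)"
      using i(2) unfolding E'_eq by auto
  qed
  then show ?thesis unfolding nbrs'(4) by (intro exI conjI) simp_all
qed

lemma boundary_link':
  assumes "x \<in> B"
  shows "\<exists>xs. xs \<noteq> [] \<and> path_list xs (E' `` {x}) E'"
proof -
  interpret ba: disk_edge V E B b a c u v by (rule swap_ab)
  interpret vu: disk_edge V E B a b c v u by (rule swap_uv)
  consider "x = a" | "x = b" | "x = u" | "x = v" | "x \<notin> {a, b, c, u, v}" using assms c_not_B by auto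
  then show ?thesis
  proof cases
    case 5
    obtain xs where xs: "xs \<noteq> []" "path_list xs (E `` {x}) E" using boundary_link assms by blast
    have "(y, z) \<in> E' \<longleftrightarrow> (y, z) \<in> E" if yz: "y \<in> E `` {x}" "z \<in> E `` {x}" for y z
    proof -
      have "y \<noteq> c" "z \<noteq> c" using yz fresh by auto
      \<comment> \<open>As \<open>x\<close> is neither \<open>u\<close> nor \<open>v\<close>, its
        link does not contain the edge \<open>ab\<close>.\<close>
      moreover have "\<not> (a \<in> E `` {x} \<and> b \<in> E `` {x})" using commonD[of x] 5 symE by auto
      ultimately show ?thesis using yz unfolding E'_eq by auto
    qed
    then have "path_list xs (E `` {x}) E'" using path_list_map[OF xs(2), of id E'] by simp
    then show ?thesis using xs(1) nbrs'(6)[OF 5] by auto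
  next
    case 1
    then show ?thesis using assms boundary_link_a by simp
  next
    case 2
    then show ?thesis using assms ba.boundary_link_a unfolding refine_commute[of E b a c] by simp
  next
    case 3
    then show ?thesis using assms boundary_link_u by simp
  next
    case 4
    then show ?thesis using assms vu.boundary_link_u by simp
  qed
qed

text \<open>The refinement arises by coning off the link \<open>{a, b, u, v}\<close> of \<open>c\<close> and then removing the edge
  \<open>ab\<close>. Faces through \<open>ab\<close> other than \<open>abc\<close> are traded for the opposite side of a tetrahedron; since
  \<open>ab\<close> is not in the boundary, \<open>abc\<close> then does not occur either.\<close>

lemma acyclic1': "acyclic1 E'"
  unfolding acyclic1_def
proof (intro allI impI)
  let ?F = "E \<union> E'"
  have F: "finite ?F" "sym ?F" "irrefl ?F"
    using finite_E sym sym_E' irrefl irrefl_E'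
    by (auto simp: E'_eq sym_def irrefl_def)
  have "acyclic1 ?F"
  proof (rule acyclic1_if_acyclic1_del[OF F])
    have link: "?F `` {c} = {v, u, b, a}" using nbrs'(1) fresh by auto
    \<comment> \<open>Every other vertex of the link of \<open>c\<close> is attached to
      \<open>a\<close>; for \<open>b\<close> this relies on the edge \<open>ab\<close> being still
      present in \<open>?F\<close>.\<close>
    have "acyclic0 {b, a} ?F"
      using edges F by (intro acyclic0_insert[OF acyclic0_singleton, of a]) auto
    then have "acyclic0 {u, b, a} ?F"
      by (rule acyclic0_insert[of _ _ a]) (use edges F in auto)
    then have "acyclic0 {v, u, b, a} ?F"
      by (rule acyclic0_insert[of _ _ a]) (use edges F in auto)
    then show "acyclic0 (?F `` {c}) ?F" by (simp only: link)
    have "?F \<inter> (- {c}) \<times> (- {c}) = E" using fresh unfolding E'_eq by auto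
    then show "acyclic1 (?F \<inter> (- {c}) \<times> (- {c}))" using acyclic by simp
  qed
  fix D assume D: "D \<subseteq> E'" "sym D" "even_degrees D"
  have fin: "finite S" if "S \<subseteq> triangles ?F" for S
    using that F finite_triangles finite_subset by blast
  \<comment> \<open>By the last conjunct a trade creates no face on \<open>ab\<close> other than
    \<open>abc\<close>, so the trade for \<open>v\<close> cannot restore the face removed by the
    trade for \<open>u\<close>.\<close>
  have trade: "\<exists>S' \<subseteq> triangles ?F. face_boundary S' = face_boundary S \<and> {a, b, z} \<notin> S' \<and>
      (\<forall>t. a \<in> t \<and> b \<in> t \<and> t \<noteq> {a, b, c} \<and> t \<notin> S \<longrightarrow> t \<notin> S')"
    if S: "S \<subseteq> triangles ?F" and z: "z = u \<or> z = v" for S z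
  proof (cases "{a, b, z} \<in> S")
    case False
    then show ?thesis using S by blast
  next
    case True
    let ?Q = "{{a, b, c}, {a, b, z}, {a, c, z}, {b, c, z}}"
    have Q: "face_boundary ?Q = {}" using z distinct by (intro face_boundary_tetrahedron) auto
    have z_ne: "z \<noteq> a" "z \<noteq> b" "z \<noteq> c" using z distinct by auto
    have "?Q \<subseteq> triangles ?F"
      using z F ab edges by (auto intro!: triangleI simp: E'_eq)
    moreover have "{a, b, z} \<notin> sym_diff S ?Q" using True by auto
    moreover have "face_boundary (sym_diff S ?Q) = face_boundary S"
      using fin[OF S] Q by (subst face_boundary_sym_diff) auto
    moreover have "t \<notin> sym_diff S ?Q" if "a \<in> t" "b \<in> t" "t \<noteq> {a, b, c}" "t \<notin> S" for t
      using that z_ne distinct True by auto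
    moreover have "sym_diff S ?Q \<subseteq> triangles ?F" using calculation(1) S by blast
    ultimately show ?thesis by (intro exI[of _ "sym_diff S ?Q"] conjI allI impI) metis+
  qed
  obtain S0 where S0: "S0 \<subseteq> triangles ?F" "face_boundary S0 = D"
    using acyclic1E[OF \<open>acyclic1 ?F\<close>, of D] D by auto
  obtain S1 where S1: "S1 \<subseteq> triangles ?F" "face_boundary S1 = D" "{a, b, u} \<notin> S1"
    using trade[OF S0(1), of u] S0(2) by auto
  from trade[OF S1(1) disjI2[OF refl]] obtain S where S': "S \<subseteq> triangles ?F \<and>
      face_boundary S = face_boundary S1 \<and> {a, b, v} \<notin> S \<and>
      (\<forall>t. a \<in> t \<and> b \<in> t \<and> t \<noteq> {a, b, c} \<and> t \<notin> S1 \<longrightarrow> t \<notin> S)"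
    by (rule exE)
  moreover have "{a, b, u} \<noteq> {a, b, c}" using distinct by auto
  ultimately have "{a, b, u} \<notin> S" using S1(3) by simp
  then have S: "S \<subseteq> triangles ?F" "face_boundary S = D" "{a, b, u} \<notin> S" "{a, b, v} \<notin> S"
    using S' S1(2) by simp_all
  have only_c: "t = {a, b, c}" if t: "t \<in> S" "a \<in> t" "b \<in> t" for t
  proof -
    obtain z where z: "t = {a, b, z}" "z \<noteq> a" "z \<noteq> b" "(a, b) \<in> ?F" "(a, z) \<in> ?F" "(b, z) \<in> ?F"
      by (rule triangleE[OF subsetD[OF S(1) t(1)] t(2,3) distinct(1)])
    then have "z = c \<or> z = u \<or> z = v"
      using commonD[of z] by (auto simp: E'_eq)
    then show ?thesis using z(1) t(1) S(3,4) by auto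
  qed
  have none: "\<not> (a \<in> t \<and> b \<in> t)" if t: "t \<in> S" for t
  proof
    assume "a \<in> t \<and> b \<in> t"
    then have "{t \<in> S. a \<in> t \<and> b \<in> t} = {t}" using t only_c by auto
    then have "card {t \<in> S. a \<in> t \<and> b \<in> t} = 1" by simp
    then have "(a, b) \<in> face_boundary S" using distinct(1) by (simp add: face_boundary_def)
    then show False using S(2) D(1) distinct unfolding E'_eq by auto
  qed
  have "S \<subseteq> triangles E'"
  proof
    fix t assume t: "t \<in> S"
    then have "t \<in> triangles ?F" using S by blast
    moreover have "(x, y) \<in> E'" if "(x, y) \<in> ?F" "x \<in> t" "y \<in> t" for x y
      using that none[OF t] unfolding E'_eq by blast
    ultimately show "t \<in> triangles E'" unfolding triangles_def by blast
  qed
  then show "\<exists>S\<subseteq>triangles E'. face_boundary S = D" using S(2) by blast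
qed

lemma disk_refine: "disk (insert c V) E' B"
proof
  show "E' \<subseteq> insert c V \<times> insert c V" using E_subset edges unfolding E'_eq by auto
  show "finite (insert c V)" "B \<subseteq> insert c V" using finite_V B_subset by auto
  show "sym E'" "irrefl E'" "acyclic1 E'" by (rule sym_E' irrefl_E' acyclic1')+
  fix x y
  assume xy: "(x, y) \<in> E'"
  show "card (E' `` {x} \<inter> E' `` {y}) = (if x \<in> B \<and> y \<in> B then 1 else 2)"
    using xy by (rule codegree')
  fix z w
  assume "(x, z) \<in> E'" "(y, z) \<in> E'" "(x, w) \<in> E'" "(y, w) \<in> E'"
  with xy show "(z, w) \<notin> E'" by (rule K4_free')
next
  fix x
  assume "x \<in> B"
  then show "\<exists>xs. xs \<noteq> [] \<and> path_list xs (E' `` {x}) E'" by (rule boundary_link')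
qed

text \<open>The deleted edge does not lie inside \<open>B\<close> and every new edge contains
  \<open>c\<close>, so the boundary circle and its length persist.\<close>

lemma refine_boundary: "E' \<inter> B \<times> B = E \<inter> B \<times> B"
  using interior c_not_B unfolding E'_eq by auto

end

section \<open>Boundary length and colourings\<close>

lemma disk_edge_exists:
  assumes "disk V E B" "(a, b) \<in> E" "\<not> (a \<in> B \<and> b \<in> B)" "c \<notin> V"
  obtains u v where "disk_edge V E B a b c u v"
proof -
  interpret disk V E B by fact
  have "card (E `` {a} \<inter> E `` {b}) = 2" using codegree assms(2,3) by simp
  then obtain u v where "E `` {a} \<inter> E `` {b} = {u, v}" "u \<noteq> v" by (auto simp: card_2_iff)
  then have "disk_edge V E B a b c u v" by unfold_locales (use assms in auto)
  then show thesis by (rule that)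
qed

lemma interior_refinement_disk:
  assumes "disk (pverts G) (parcs G) B" "interior_refinement G G'"
  shows "disk (pverts G') (parcs G') B \<and> parcs G' \<inter> B \<times> B = parcs G \<inter> B \<times> B"
proof -
  obtain a b c where abc: "interior_edge (with_proj G) a b" "c \<notin> pverts G" "G' = edge_refinement G a b c"
    using assms(2) by (auto simp: interior_refinement_def)
  have "(a, b) \<in> parcs G" "\<not> (a \<in> B \<and> b \<in> B)"
    using abc(1) boundary_verts_disk[OF assms(1)] by (auto simp: interior_edge_def)
  then obtain u v where "disk_edge (pverts G) (parcs G) B a b c u v"
    using disk_edge_exists[OF assms(1)] abc(2) by metis
  then show ?thesis
    using disk_edge.disk_refine disk_edge.refine_boundary by (fastforce simp: abc(3) edge_refinement_eq)
qed

lemma interior_refinements_disk: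
  assumes "interior_refinement\<^sup>*\<^sup>* G G'" "disk (pverts G) (parcs G) B"
  shows "disk (pverts G') (parcs G') B \<and> parcs G' \<inter> B \<times> B = parcs G \<inter> B \<times> B"
  using assms by (induction rule: rtranclp_induct) (use interior_refinement_disk in blast)+

section \<open>Divisibility by counting incidences of edges and faces\<close>

lemma card_ordered_pairs_triangle:
  assumes "t \<in> triangles E" "irrefl E"
  shows "card {e \<in> E. fst e \<in> t \<and> snd e \<in> t} = 6"
proof -
  have t: "card t = 3" "finite t" using assms by (auto simp: triangles_def card_ge_0_finite)
  have "{e \<in> E. fst e \<in> t \<and> snd e \<in> t} = t \<times> t - (\<lambda>x. (x, x)) ` t"
    using assms by (auto simp: triangles_def irrefl_def)
  moreover have "card ((\<lambda>x. (x, x)) ` t) = 3" using t by (simp add: card_image inj_on_def)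
  moreover have "card (t \<times> t - (\<lambda>x. (x, x)) ` t) = card (t \<times> t) - card ((\<lambda>x. (x, x)) ` t)"
    using t by (intro card_Diff_subset) auto
  ultimately show ?thesis using t by (simp add: card_cartesian_product)
qed

text \<open>Evenness of all degrees enters by taking the whole edge set as the 1-cycle. Edges are
  ordered pairs, so the boundary length appears as \<open>2 * L\<close>.\<close>

lemma (in disk) three_dvd_boundary_length:
  assumes even: "even_degrees E" and L: "card (E \<inter> B \<times> B) = 2 * L"
  shows "3 dvd L"
proof -
  obtain S where S: "S \<subseteq> triangles E" "face_boundary S = E"
    using acyclic1E[OF acyclic, of E] sym even by auto
  let ?T = "triangles E"
  have finT: "finite ?T" using finite_E by (rule finite_triangles)
  have faces: "card {t \<in> ?T. fst e \<in> t \<and> snd e \<in> t} = (if e \<in> B \<times> B then 1 else 2)" if "e \<in> E" for e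
    using that triangles_through_edge(2)[OF sym irrefl, of "fst e" "snd e"] codegree[of "fst e" "snd e"]
    by (cases e) auto
  \<comment> \<open>The count is odd and bounded by the number of faces on the edge, which is at
    most 2.\<close>
  have one: "card {t \<in> S. fst e \<in> t \<and> snd e \<in> t} = 1" if "e \<in> E" for e
  proof -
    have "odd (card {t \<in> S. fst e \<in> t \<and> snd e \<in> t})"
      using that S(2) by (cases e) (auto simp: face_boundary_def)
    moreover have "card {t \<in> S. fst e \<in> t \<and> snd e \<in> t} \<le> card {t \<in> ?T. fst e \<in> t \<and> snd e \<in> t}"
      using finT S(1) by (intro card_mono) auto
    ultimately show ?thesis using faces[OF that] by (auto split: if_splits elim!: oddE)
  qed
  \<comment> \<open>Double counting of incidences between faces and ordered edges, six for each
    face.\<close>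
  have count: "(\<Sum>t\<in>R. 6) = (\<Sum>e\<in>E. card {t \<in> R. fst e \<in> t \<and> snd e \<in> t})" if R: "R \<subseteq> ?T" for R
  proof -
    have "finite R" using R finT by (rule finite_subset)
    then have "(\<Sum>e\<in>E. card {t \<in> R. fst e \<in> t \<and> snd e \<in> t}) = (\<Sum>t\<in>R. 6)"
      using finite_E R card_ordered_pairs_triangle[OF _ irrefl]
      by (intro sum_multicount_gen) auto
    then show ?thesis by simp
  qed
  have "6 * card S = card E" using count[OF S(1)] one by simp
  moreover have "6 * card ?T + 2 * L = 2 * card E"
  proof -
    have "6 * card ?T = (\<Sum>e\<in>E. if e \<in> B \<times> B then 1 else 2)"
      using count[OF subset_refl] faces by simp
    also have "\<dots> + card (E \<inter> B \<times> B) = 2 * card E"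
    proof -
      have "card E = card (E \<inter> B \<times> B) + card (E - B \<times> B)"
        using finite_E by (simp add: card_Diff_subset_Int card_mono)
      moreover have "(\<Sum>e\<in>E. if e \<in> B \<times> B then 1 else 2) = card (E \<inter> B \<times> B) + 2 * card (E - B \<times> B)"
        using finite_E by (simp add: sum.If_cases set_diff_eq Int_def Collect_neg_eq)
      ultimately show ?thesis by simp
    qed
    finally show ?thesis using L by simp
  qed
  \<comment> \<open>Eliminating \<open>card E\<close> gives
    \<open>L = 6 * card S - 3 * card ?T\<close>.\<close>
  ultimately show ?thesis by presburger
qed

section \<open>Colourings and the removal of monochromatic edges\<close>

definition monochromatic :: "'a rel \<Rightarrow> ('a \<Rightarrow> nat) \<Rightarrow> 'a rel" where
  "monochromatic E f = {(x, y) \<in> E. f x = f y}"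

text \<open>As \<open>c\<close> is new, colouring it affects no old pair; the colour
  \<open>k\<close> matters only against the four neighbours of \<open>c\<close>.\<close>

lemma (in disk_edge) monochromatic_refine:
  "monochromatic E' (f(c := k)) = (monochromatic E f - {(a, b), (b, a)}) \<union>
     {(x, y). (x, y) \<in> {c} \<times> {a, b, u, v} \<union> {a, b, u, v} \<times> {c} \<and> k = (if x = c then f y else f x)}"
  unfolding monochromatic_def E'_eq using fresh distinct by auto

text \<open>A monochromatic edge \<open>ab\<close> is refined with a colour not used on \<open>a, u, v\<close>. If there is none,
  \<open>c\<close> receives the colour of \<open>u\<close>, and the new monochromatic edge \<open>cu\<close>, whose two common
  neighbours \<open>a\<close> and \<open>b\<close> have the same colour, is refined in turn.\<close>

lemma refine_to_proper_colouring:
  fixes G :: "('a :: infinite) pair_pre_digraph" and f :: "'a \<Rightarrow> nat"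
  assumes "disk (pverts G) (parcs G) B" "\<And>x. x \<in> pverts G \<Longrightarrow> f x < 3"
    "monochromatic (parcs G) f \<inter> B \<times> B = {}"
  shows "\<exists>G' g. interior_refinement\<^sup>*\<^sup>* G G' \<and> (\<forall>x\<in>pverts G'. g x < 3) \<and>
    monochromatic (parcs G') g = {} \<and> (\<forall>x\<in>B. g x = f x)"
  using assms
proof (induction "card (monochromatic (parcs G) f)" arbitrary: G f rule: less_induct)
  case less
  let ?V = "pverts G" and ?E = "parcs G"
  interpret disk ?V ?E B by fact
  show ?case
  proof (cases "monochromatic ?E f = {}")
    case True
    then show ?thesis using less.prems by blast
  next
    case False
    then obtain a b where "(a, b) \<in> monochromatic ?E f" by auto
    then have ab: "(a, b) \<in> ?E" "f a = f b" and int: "\<not> (a \<in> B \<and> b \<in> B)"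
      using less.prems(3) by (auto simp: monochromatic_def)
    have fresh: "\<exists>c. c \<notin> X" if "finite X" for X :: "'a set"
      using that ex_new_if_finite infinite_UNIV by blast
    obtain c where "c \<notin> ?V" using fresh finite_V by blast
    then obtain u v where "disk_edge ?V ?E B a b c u v"
      using disk_edge_exists[OF less.prems(1) ab(1) int] by metis
    then interpret e: disk_edge ?V ?E B a b c u v .
    define G1 where "G1 = edge_refinement G a b c"
    have G1: "pverts G1 = insert c ?V" "parcs G1 = e.E'" by (simp_all add: G1_def edge_refinement_eq)
    have step1: "interior_refinement G G1"
      using ab int e.c boundary_verts_disk[OF less.prems(1)]
      unfolding interior_refinement_def interior_edge_def G1_def by auto
    have smaller: "card (monochromatic ?E f - {(a, b), (b, a)}) < card (monochromatic ?E f)"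
    proof (rule psubset_card_mono)
      show "finite (monochromatic ?E f)"
        using finite_E by (rule finite_subset[rotated]) (auto simp: monochromatic_def)
      show "monochromatic ?E f - {(a, b), (b, a)} \<subset> monochromatic ?E f"
        using ab by (auto simp: monochromatic_def)
    qed
    have in_V: "a \<in> ?V" "u \<in> ?V" "v \<in> ?V" using e.edges ab E_subset by auto
    \<comment> \<open>Both cases below remove exactly the edge \<open>ab\<close> from the
      monochromatic ones and keep the colours on \<open>B\<close>; the induction hypothesis then
      completes either of them.\<close>
    have finish: ?thesis
      if G2: "interior_refinement\<^sup>*\<^sup>* G G2" "\<And>x. x \<in> pverts G2 \<Longrightarrow> g x < 3" "\<And>x. x \<in> B \<Longrightarrow> g x = f x"
        "monochromatic (parcs G2) g = monochromatic ?E f - {(a, b), (b, a)}" for G2 g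
    proof -
      have "disk (pverts G2) (parcs G2) B"
        using interior_refinements_disk[OF G2(1) less.prems(1)] by blast
      moreover have "monochromatic (parcs G2) g \<inter> B \<times> B = {}" using G2(4) less.prems(3) by blast
      moreover have "card (monochromatic (parcs G2) g) < card (monochromatic ?E f)"
        using smaller G2(4) by simp
      ultimately obtain G' g' where "interior_refinement\<^sup>*\<^sup>* G2 G'" "\<forall>x\<in>pverts G'. g' x < 3"
        "monochromatic (parcs G') g' = {}" "\<forall>x\<in>B. g' x = g x"
        using less.hyps[of G2 g] G2(2) by metis
      moreover have "interior_refinement\<^sup>*\<^sup>* G G'"
        using G2(1) calculation(1) by (rule rtranclp_trans)
      moreover have "\<forall>x\<in>B. g' x = f x" using calculation(4) G2(3) by simp
      ultimately show ?thesis by blast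
    qed
    show ?thesis
    proof (cases "\<exists>k<3. k \<notin> {f a, f u, f v}")
      case True
      then obtain k where k: "k < 3" "k \<notin> {f a, f u, f v}" by blast
      show ?thesis
      proof (rule finish)
        show "interior_refinement\<^sup>*\<^sup>* G G1" using step1 by blast
        show "monochromatic (parcs G1) (f(c := k)) = monochromatic ?E f - {(a, b), (b, a)}"
          unfolding G1 e.monochromatic_refine using k ab(2) by auto
      qed (use k less.prems(2) e.c_not_B in \<open>auto simp: G1\<close>)
    next
      case False
      have "f u \<noteq> f a \<and> f v \<noteq> f a \<and> f u \<noteq> f v"
      proof -
        have "k \<in> {f a, f u, f v}" if "k < 3" for k using False that by blast
        from this[of 0] this[of 1] this[of 2] show ?thesis by auto
      qed
      then have neq: "f u \<noteq> f a" "f v \<noteq> f a" "f u \<noteq> f v" by auto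
      define f1 where "f1 = f(c := f u)"
      have mono1: "monochromatic (parcs G1) f1 =
          (monochromatic ?E f - {(a, b), (b, a)}) \<union> {(c, u), (u, c)}"
        unfolding G1 f1_def e.monochromatic_refine using neq ab(2) e.distinct by auto
      have disk1: "disk (pverts G1) (parcs G1) B" using e.disk_refine by (simp add: G1)
      obtain d where "d \<notin> pverts G1" using fresh[of "pverts G1"] disk.finite_V[OF disk1] by blast
      have cu: "(c, u) \<in> parcs G1" by (simp add: G1 e.E'_eq)
      have common: "parcs G1 `` {c} \<inter> parcs G1 `` {u} = {a, b}"
        unfolding G1 e.nbrs' using e.edges e.distinct e.not_uv e.irreflE by auto
      have "disk_edge (pverts G1) (parcs G1) B c u d a b"
        using disk1 cu e.c_not_B \<open>d \<notin> pverts G1\<close> common e.distinct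
        by (simp add: disk_edge_def disk_edge_axioms_def)
      then interpret e1: disk_edge "pverts G1" "parcs G1" B c u d a b .
      define G2 where "G2 = edge_refinement G1 c u d"
      have G2: "pverts G2 = insert d (pverts G1)" "parcs G2 = e1.E'"
        by (simp_all add: G2_def edge_refinement_eq)
      have step2: "interior_refinement G1 G2"
        using cu e.c_not_B e1.c boundary_verts_disk[OF disk1]
        unfolding interior_refinement_def interior_edge_def G2_def by auto
      have "f u < 3" using less.prems(2) in_V by auto
      \<comment> \<open>The third colour is \<open>f v\<close>: it differs from the colour shared by
        \<open>a\<close> and \<open>b\<close> and from the one shared by \<open>c\<close> and
        \<open>u\<close>.\<close>
      obtain k where k: "k < 3" "k \<noteq> f a" "k \<noteq> f u"
      proof -
        have "f v < 3" using less.prems(2) in_V by auto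
        then show thesis using that[of "f v"] neq by simp
      qed
      show ?thesis
      proof (rule finish)
        show "interior_refinement\<^sup>*\<^sup>* G G2" using step1 step2 by (meson rtranclp.simps r_into_rtranclp)
        show "monochromatic (parcs G2) (f1(d := k)) = monochromatic ?E f - {(a, b), (b, a)}"
        proof -
          have f1: "f1 c = f u" "f1 u = f u" "f1 a = f a" "f1 b = f a"
            using e.distinct ab(2) by (auto simp: f1_def)
          have "(c, u) \<notin> monochromatic ?E f" "(u, c) \<notin> monochromatic ?E f"
            using e.fresh by (auto simp: monochromatic_def)
          then show ?thesis
            unfolding G2 e1.monochromatic_refine mono1 using k f1 by auto
        qed
      qed (use k \<open>f u < 3\<close> less.prems(2) e.c_not_B e1.c_not_B in \<open>auto simp: G2 G1 f1_def\<close>)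
    qed
  qed
qed

text \<open>The edges of the link of \<open>v\<close> join its two colour classes; counting them from either side
  shows that the classes have equal size.\<close>

lemma (in disk) even_degree_if_coloured:
  fixes f :: "'a \<Rightarrow> nat"
  assumes f: "\<And>x. x \<in> V \<Longrightarrow> f x < 3" and proper: "monochromatic E f = {}"
    and boundary: "v \<in> B \<Longrightarrow> \<exists>p q. E `` {v} \<inter> B = {p, q} \<and> f p \<noteq> f q"
  shows "even (card (E `` {v}))"
proof (cases "v \<in> V")
  case False
  then have "E `` {v} = {}" using E_subset by auto
  then show ?thesis by simp
next
  case True
  have neq: "f x \<noteq> f y" if "(x, y) \<in> E" for x y
    using that proper by (auto simp: monochromatic_def)
  obtain i j where ij: "i < 3" "j < 3" "i \<noteq> j" "i \<noteq> f v" "j \<noteq> f v"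
  proof -
    have "f v = 0 \<or> f v = 1 \<or> f v = 2" using f[OF True] by auto
    then show thesis using that[of 1 2] that[of 0 2] that[of 0 1] by auto
  qed
  define A where "A k = {w \<in> E `` {v}. f w = k}" for k
  have fin: "finite (E `` {v})" using finite_E by (auto intro: finite_Image)
  have finA: "finite (A k)" for k by (rule finite_subset[OF _ fin]) (auto simp: A_def)
  have cover: "f w = i \<or> f w = j" if "w \<in> E `` {v}" for w
  proof -
    have "f w < 3" "f w \<noteq> f v" using that f E_subset neq[of v w] by auto
    then show ?thesis using ij f[OF True] by linarith
  qed
  have split: "E `` {v} = A i \<union> A j" using cover by (auto simp: A_def)
  have disj: "A i \<inter> A j = {}" using ij by (auto simp: A_def)
  have card: "card (E `` {v}) = card (A i) + card (A j)"
    unfolding split using finA disj by (intro card_Un_disjoint) auto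
  \<comment> \<open>The degree of \<open>w\<close> inside the link of \<open>v\<close>, which is the
    number of common neighbours of \<open>v\<close> and \<open>w\<close>.\<close>
  define d where "d w = (if v \<in> B \<and> w \<in> B then 1 else 2 :: nat)" for w
  have deg: "card {y \<in> A l. (w, y) \<in> E} = d w" if "w \<in> A k" "{k, l} = {i, j}" for w k l
  proof -
    have "{y \<in> A l. (w, y) \<in> E} = E `` {v} \<inter> E `` {w}"
    proof -
      have "f y = l" if "y \<in> E `` {v}" "(w, y) \<in> E" for y
        using cover[OF that(1)] neq[OF that(2)] \<open>w \<in> A k\<close> \<open>{k, l} = {i, j}\<close>
        by (auto simp: A_def doubleton_eq_iff)
      then show ?thesis by (auto simp: A_def)
    qed
    then show ?thesis using codegree[of v w] that by (simp add: A_def d_def)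
  qed
  have "(\<Sum>w\<in>A i. card {y \<in> A j. (w, y) \<in> E}) = (\<Sum>y\<in>A j. d y)"
  proof (rule sum_multicount_gen)
    show "\<forall>y\<in>A j. card {w \<in> A i. (w, y) \<in> E} = d y"
    proof
      fix y assume "y \<in> A j"
      then have "card {w \<in> A i. (y, w) \<in> E} = d y" by (intro deg) auto
      moreover have "(y, w) \<in> E \<longleftrightarrow> (w, y) \<in> E" for w using sym by (auto dest: symD)
      ultimately show "card {w \<in> A i. (w, y) \<in> E} = d y" by simp
    qed
  qed (use finA in auto)
  moreover have "(\<Sum>w\<in>A i. card {y \<in> A j. (w, y) \<in> E}) = (\<Sum>w\<in>A i. d w)"
    by (intro sum.cong) (auto simp: deg)
  ultimately have sums: "(\<Sum>w\<in>A i. d w) = (\<Sum>w\<in>A j. d w)" by simp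
  show ?thesis
  proof (cases "v \<in> B")
    case False
    then have "card (A i) = card (A j)" using sums by (simp add: d_def)
    then show ?thesis using card by simp
  next
    case vB: True
    then obtain p q where pq: "E `` {v} \<inter> B = {p, q}" "f p \<noteq> f q" using boundary by blast
    \<comment> \<open>Members of \<open>B\<close> have degree 1 in the link and all others degree 2.
      The correction is the same for both classes, because \<open>p\<close> and \<open>q\<close>
      fall into different ones.\<close>
    have d_sum: "(\<Sum>w\<in>A k. d w) + card (A k \<inter> B) = 2 * card (A k)" for k
    proof -
      have "card (A k) = card (A k \<inter> B) + card (A k - B)"
        using finA by (simp add: card_Diff_subset_Int card_mono)
      moreover have "(\<Sum>w\<in>A k. d w) = card (A k \<inter> B) + 2 * card (A k - B)"
        using finA vB by (simp add: d_def sum.If_cases Diff_eq)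
      ultimately show ?thesis by simp
    qed
    have "f p = i \<and> f q = j \<or> f p = j \<and> f q = i"
    proof -
      have "p \<in> E `` {v}" "q \<in> E `` {v}" using pq(1) by blast+
      then show ?thesis using pq(2) cover[of p] cover[of q] by auto
    qed
    moreover have "A k \<inter> B = {w \<in> {p, q}. f w = k}" for k
      unfolding pq(1)[symmetric] by (auto simp: A_def)
    moreover have "{w \<in> {p, q}. f w = f p} = {p}" "{w \<in> {p, q}. f w = f q} = {q}"
      using pq(2) by auto
    ultimately have "A i \<inter> B = {p} \<and> A j \<inter> B = {q} \<or> A i \<inter> B = {q} \<and> A j \<inter> B = {p}"
      by metis
    then have "card (A i \<inter> B) = card (A j \<inter> B)" by auto
    then have "card (A i) = card (A j)" using d_sum[of i] d_sum[of j] sums by linarith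
    then show ?thesis using card by simp
  qed
qed

text \<open>Colouring by the index modulo 3 is consistent across the wrap-around because
  \<open>3 dvd n\<close>. The two neighbours of a position are two steps apart, hence differ in
  colour; \<open>even_degree_if_coloured\<close> asks for this at boundary vertices.\<close>

lemma cycle_three_colouring:
  fixes p :: "nat \<Rightarrow> 'a"
  assumes p: "cycle_on n p N E" "3 \<le> n" and n: "3 dvd n"
  shows "\<exists>f :: 'a \<Rightarrow> nat. (\<forall>x. f x < 3) \<and> (\<forall>x\<in>N. \<forall>y\<in>N. (x, y) \<in> E \<longrightarrow> f x \<noteq> f y) \<and>
    (\<forall>x\<in>N. \<exists>y z. E `` {x} \<inter> N = {y, z} \<and> f y \<noteq> f z)"
proof -
  define f where "f x = inv_into {..<n} p x mod 3" for x
  have inj: "inj_on p {..<n}" and N: "N = p ` {..<n}" using p by (auto simp: cycle_on_def)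
  have f: "f (p i) = i mod 3" if "i < n" for i using inj that by (simp add: f_def)
  have succ: "f (p (Suc i mod n)) = Suc i mod 3" for i
  proof -
    have "Suc i mod n < n" using p(2) by simp
    then have "f (p (Suc i mod n)) = Suc i mod n mod 3" by (rule f)
    also have "\<dots> = Suc i mod 3" using n by (rule mod_mod_cancel)
    finally show ?thesis .
  qed
  have mod3: "Suc i mod 3 \<noteq> i mod 3" "Suc (Suc i) mod 3 \<noteq> i mod 3" for i
    by (simp_all add: mod_Suc)
  show ?thesis
  proof (intro exI[of _ f] conjI allI ballI impI)
    show "f x < 3" for x by (simp add: f_def)
  next
    fix x y
    assume xy: "x \<in> N" "y \<in> N" "(x, y) \<in> E"
    obtain i j where ij: "i < n" "x = p i" "j < n" "y = p j" using N xy(1,2) by auto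
    then have "j = Suc i mod n \<or> i = Suc j mod n" using p(1) xy(3) unfolding cycle_on_def by metis
    then show "f x \<noteq> f y"
    proof
      assume "j = Suc i mod n"
      then have "f y = Suc i mod 3" "f x = i mod 3" using succ[of i] f[of i] ij by simp_all
      then show ?thesis using mod3(1)[of i] by metis
    next
      assume "i = Suc j mod n"
      then have "f x = Suc j mod 3" "f y = j mod 3" using succ[of j] f[of j] ij by simp_all
      then show ?thesis using mod3(1)[of j] by metis
    qed
  next
    fix x
    assume x: "x \<in> N"
    obtain i where i: "i < n" "x = p i" using N x by auto
    obtain k where k: "k < n" "Suc k mod n = i" "E `` {p i} \<inter> N = {p (Suc i mod n), p k}"
      by (rule cycle_on_neighbours[OF p i(1)])
    have "i mod 3 = Suc k mod 3" using succ[of k] f[OF i(1)] k(2) by simp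
    then have "Suc i mod 3 \<noteq> k mod 3" using mod3(2)[of k] by (simp add: mod_Suc)
    then have "f (p (Suc i mod n)) \<noteq> f (p k)" using succ[of i] f[OF k(1)] by simp
    then show "\<exists>y z. E `` {x} \<inter> N = {y, z} \<and> f y \<noteq> f z"
      using k(3) unfolding i(2) by (intro exI conjI)
  qed
qed

lemma card_cycle_on:
  assumes p: "cycle_on n p N E" "3 \<le> n" and E: "E \<subseteq> N \<times> N"
  shows "card E = 2 * n"
proof -
  have fin: "finite N" "card N = n" using p by (auto simp: cycle_on_def card_image)
  have "E = (SIGMA x:N. E `` {x} \<inter> N)" using E by auto
  then have "card E = card (SIGMA x:N. E `` {x} \<inter> N)" by (rule arg_cong)
  also have "\<dots> = (\<Sum>x\<in>N. card (E `` {x} \<inter> N))" using fin(1) by (intro card_SigmaI) auto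
  also have "\<dots> = 2 * n" using cycle_on_card_neighbours[OF p] fin by simp
  finally show ?thesis .
qed

lemma out_degree_with_proj: "out_degree (with_proj G) v = card (parcs G `` {v})"
proof -
  have "out_arcs (with_proj G) v = Pair v ` (parcs G `` {v})" by (auto simp: out_arcs_def)
  then show ?thesis by (simp add: out_degree_def card_image inj_on_def)
qed

theorem mainTheorem2:
  fixes G :: "('a :: infinite) pair_pre_digraph" and L :: nat
  assumes "two_ball (with_proj G)"
    and "is_cyclic_graph L (boundary_graph (with_proj G))"
  shows "(\<exists>G'. interior_refinement\<^sup>*\<^sup>* G G' \<and>
            (\<forall>v \<in> pverts G'. even (out_degree (with_proj G') v)))
         \<longleftrightarrow> 3 dvd L"
proof -
  obtain B where G: "disk (pverts G) (parcs G) B" using two_ball_disk assms(1) by blast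
  \<comment> \<open>The boundary circle as a relation. It is shared by all refinements of
    \<open>G\<close>, so both directions can use its enumeration \<open>p\<close> in the original
    ball.\<close>
  define F where "F = parcs G \<inter> B \<times> B"
  obtain p where p: "cycle_on L p B F" "3 \<le> L"
    using is_cyclic_graphD[OF assms(2)] boundary_verts_disk[OF G]
    by (auto simp: boundary_graph_def arcs_ends_induce F_def)
  show ?thesis
  proof
    assume "\<exists>G'. interior_refinement\<^sup>*\<^sup>* G G' \<and> (\<forall>v\<in>pverts G'. even (out_degree (with_proj G') v))"
    then obtain G' where G': "interior_refinement\<^sup>*\<^sup>* G G'"
      "\<forall>v\<in>pverts G'. even (card (parcs G' `` {v}))"
      by (auto simp: out_degree_with_proj)
    have d: "disk (pverts G') (parcs G') B" "parcs G' \<inter> B \<times> B = F"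
      using interior_refinements_disk[OF G'(1) G] by (auto simp: F_def)
    have "even (card (parcs G' `` {v}))" for v
    proof (cases "v \<in> pverts G'")
      case False
      then have "parcs G' `` {v} = {}" using disk.E_subset[OF d(1)] by auto
      then show ?thesis by simp
    qed (use G' in blast)
    then have "even_degrees (parcs G')" by (simp add: even_degrees_def)
    moreover have "card F = 2 * L" using card_cycle_on[OF p] by (simp add: F_def)
    ultimately show "3 dvd L" using disk.three_dvd_boundary_length[OF d(1)] d(2) by simp
  next
    assume "3 dvd L"
    with cycle_three_colouring[OF p] obtain f :: "'a \<Rightarrow> nat" where f: "\<forall>x. f x < 3"
      "\<forall>x\<in>B. \<forall>y\<in>B. (x, y) \<in> F \<longrightarrow> f x \<noteq> f y"
      "\<forall>x\<in>B. \<exists>y z. F `` {x} \<inter> B = {y, z} \<and> f y \<noteq> f z"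
      by blast
    have "monochromatic (parcs G) f \<inter> B \<times> B = {}"
      using f(2) by (auto simp: monochromatic_def F_def)
    from refine_to_proper_colouring[OF G f(1)[rule_format] this]
    obtain G' g where G': "interior_refinement\<^sup>*\<^sup>* G G'" "\<forall>x\<in>pverts G'. g x < 3"
      "monochromatic (parcs G') g = {}" "\<forall>x\<in>B. g x = f x"
      by (elim exE conjE)
    have d: "disk (pverts G') (parcs G') B" "parcs G' \<inter> B \<times> B = F"
      using interior_refinements_disk[OF G'(1) G] by (auto simp: F_def)
    have "even (card (parcs G' `` {v}))" for v
    proof (rule disk.even_degree_if_coloured[OF d(1)])
      show "g x < 3" if "x \<in> pverts G'" for x using G'(2) that by blast
      show "monochromatic (parcs G') g = {}" by (rule G'(3))
      assume v: "v \<in> B"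
      have "parcs G' `` {v} \<inter> B = F `` {v} \<inter> B" using v d(2) by auto
      moreover obtain y z where "F `` {v} \<inter> B = {y, z}" "f y \<noteq> f z" using f(3) v by blast
      moreover from this have "g y = f y" "g z = f z" using G'(4) by auto
      ultimately show "\<exists>p q. parcs G' `` {v} \<inter> B = {p, q} \<and> g p \<noteq> g q" by metis
    qed
    then show "\<exists>G'. interior_refinement\<^sup>*\<^sup>* G G' \<and> (\<forall>v\<in>pverts G'. even (out_degree (with_proj G') v))"
      using G'(1) by (auto simp: out_degree_with_proj)
  qed
qed

end
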